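(* Let $(S,\mu,\prec)$ be an ordered probability space, and let $W$ be a monotone kernel on $(S,\prec)$. Then there is a monotone kernel $W'$ on $[0,1]$ (with Lebesgue measure and the standard order) that is equivalent to $W$. Equivalently, $\Gamma_W\in\mathcal U_\uparrow$, i.e., the graph limit $\Gamma_W$ is monotone.
   Context: An ordered probability space $(S,\mu,\prec)$ is a probability space $(S,\mathcal F,\mu)$ together with a (strict) linear order $\prec$ on $S$ that is measurable, i.e., $\{(x,y):x\prec y\}$ is a measurable subset of $S\times S$ (with the product $\sigma$-field). A kernel on $S$ is a symmetric measurable function $W:S^2\to[0,1]$. It is monotone on $(S,\prec)$ if $W(x_1,y_1)\le W(x_2,y_2)$ whenever $x_1\preceq x_2$ and $y_1\preceq y_2$. For $W\in L^1(S^2)$ the cut norm is $\|W\|_{\square}=\sup\bigl|\int_{S^2}W(x,y)f(x)g(y)\,d\mu(x)\,d\mu(y)\bigr|$, the supremum being over measurable $f,g:S\to[-1,1]$. For kernels $W_1$ on $S_1$ and $W_2$ on $S_2$, $\delta_\square(W_1,W_2)=\inf\|W_1^{\varphi_1}-W_2^{\varphi_2}\|_\square$, the infimum being over all pairs of measure-preserving maps $\varphi_1:S_3\to S_1$, $\varphi_2:S_3\to S_2$ from a common probability space $S_3$, where $W^\varphi(x,y)=W(\varphi(x),\varphi(y))$. Kernels with $\delta_\square(W_1,W_2)=0$ are called equivalent. Graph limits are identified with equivalence classes of kernels, $\Gamma_W$ denoting the class of $W$. The set $\mathcal U_\uparrow$ of monotone graph limits is the set of graph limits of the form $\Gamma_{W'}$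 with $W'$ a monotone kernel on $[0,1]$. *)

theory Defs
  imports "HOL-Probability.Probability"
begin

text \<open>
  Since \<^term>\<open>r \<in> sets (M \<Otimes>\<^sub>M M)\<close> forces \<^term>\<open>r \<subseteq> space M \<times> space M\<close>, the global
  transitivity and irreflexivity demanded by \<^const>\<open>strict_linear_order_on\<close> are those of
  an order on \<^term>\<open>space M\<close>.
\<close>

locale ordered_prob_space = prob_space M for M :: "'a measure" +
  fixes r :: "'a rel"
  assumes strict_linear_order: "strict_linear_order_on (space M) r"
    and measurable_order: "r \<in> sets (M \<Otimes>\<^sub>M M)"

definition is_kernel :: "'a measure \<Rightarrow> ('a \<Rightarrow> 'a \<Rightarrow> real) \<Rightarrow> bool" where
  "is_kernel M W \<longleftrightarrow>
     (\<lambda>(x, y). W x y) \<in> borel_measurable (M \<Otimes>\<^sub>M M) \<and>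
     (\<forall>x\<in>space M. \<forall>y\<in>space M. W x y \<in> {0..1} \<and> W x y = W y x)"

definition monotone_kernel :: "'a measure \<Rightarrow> 'a rel \<Rightarrow> ('a \<Rightarrow> 'a \<Rightarrow> real) \<Rightarrow> bool" where
  "monotone_kernel M r W \<longleftrightarrow> is_kernel M W \<and>
     (\<forall>x\<^sub>1\<in>space M. \<forall>x\<^sub>2\<in>space M. \<forall>y\<^sub>1\<in>space M. \<forall>y\<^sub>2\<in>space M.
        (x\<^sub>1, x\<^sub>2) \<in> r\<^sup>= \<longrightarrow> (y\<^sub>1, y\<^sub>2) \<in> r\<^sup>= \<longrightarrow> W x\<^sub>1 y\<^sub>1 \<le> W x\<^sub>2 y\<^sub>2)"

definition unit_interval :: "real measure" where
  "unit_interval = restrict_space lborel {0..1}"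

definition unit_order :: "real rel" where
  "unit_order = {(x, y). x \<in> {0..1} \<and> y \<in> {0..1} \<and> x < y}"

definition cut_norm :: "'a measure \<Rightarrow> ('a \<Rightarrow> 'a \<Rightarrow> real) \<Rightarrow> real" where
  "cut_norm M W =
     Sup {\<bar>\<integral>(x, y). W x y * f x * g y \<partial>(M \<Otimes>\<^sub>M M)\<bar> | f g.
       f \<in> borel_measurable M \<and> f \<in> space M \<rightarrow> {-1..1} \<and>
       g \<in> borel_measurable M \<and> g \<in> space M \<rightarrow> {-1..1}}"

definition measure_preserving :: "'a measure \<Rightarrow> 'b measure \<Rightarrow> ('a \<Rightarrow> 'b) set" where
  "measure_preserving M N = {\<phi> \<in> M \<rightarrow>\<^sub>M N. distr M N \<phi> = N}"

definition pullback :: "('b \<Rightarrow> 'b \<Rightarrow> real) \<Rightarrow> ('a \<Rightarrow> 'b) \<Rightarrow> 'a \<Rightarrow> 'a \<Rightarrow> real" where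
  "pullback W \<phi> x y = W (\<phi> x) (\<phi> y)"

text \<open>
  A HOL formula cannot quantify over the carrier type of the common space \<open>S\<close>, so it is
  taken to be \<^typ>\<open>'a \<times> 'b\<close>.  This loses nothing: by \<open>delta_cut_le\<close> below, common
  spaces carried by any other type do not lower the infimum.
\<close>

definition delta_cut ::
  "'a measure \<Rightarrow> ('a \<Rightarrow> 'a \<Rightarrow> real) \<Rightarrow> 'b measure \<Rightarrow> ('b \<Rightarrow> 'b \<Rightarrow> real) \<Rightarrow> real" where
  "delta_cut M\<^sub>1 W\<^sub>1 M\<^sub>2 W\<^sub>2 =
     Inf {cut_norm S (\<lambda>x y. pullback W\<^sub>1 \<phi>\<^sub>1 x y - pullback W\<^sub>2 \<phi>\<^sub>2 x y)
       | (S :: ('a \<times> 'b) measure) \<phi>\<^sub>1 \<phi>\<^sub>2.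
       prob_space S \<and> \<phi>\<^sub>1 \<in> measure_preserving S M\<^sub>1 \<and> \<phi>\<^sub>2 \<in> measure_preserving S M\<^sub>2}"

definition equivalent_kernels ::
  "'a measure \<Rightarrow> ('a \<Rightarrow> 'a \<Rightarrow> real) \<Rightarrow> 'b measure \<Rightarrow> ('b \<Rightarrow> 'b \<Rightarrow> real) \<Rightarrow> bool" where
  "equivalent_kernels M\<^sub>1 W\<^sub>1 M\<^sub>2 W\<^sub>2 \<longleftrightarrow> delta_cut M\<^sub>1 W\<^sub>1 M\<^sub>2 W\<^sub>2 = 0"

text \<open>
  The equivalence class of a kernel ranges over kernels on all probability spaces, and is
  rendered type by type: \<open>graph_limit M W\<close> is the part of the class of \<open>W\<close> carried by
  \<^typ>\<open>'c\<close>.  For \<^typ>\<open>real\<close> in place of \<^typ>\<open>'c\<close> this part includes all members of the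
  class that live on the unit interval, and so determines the class.
\<close>

definition graph_limit ::
  "'a measure \<Rightarrow> ('a \<Rightarrow> 'a \<Rightarrow> real) \<Rightarrow> ('c measure \<times> ('c \<Rightarrow> 'c \<Rightarrow> real)) set" where
  "graph_limit M W = {(N, V). prob_space N \<and> is_kernel N V \<and> equivalent_kernels M W N V}"

definition monotone_graph_limits :: "('c measure \<times> ('c \<Rightarrow> 'c \<Rightarrow> real)) set set" where
  "monotone_graph_limits =
     {graph_limit unit_interval W' | W'. monotone_kernel unit_interval unit_order W'}"

lemma ordered_prob_space_unit_interval: "ordered_prob_space unit_interval unit_order"
proof -
  interpret prob_space unit_interval
    by (rule prob_spaceI) (simp add: unit_interval_def space_restrict_space emeasure_restrict_space)
  have sp: "space unit_interval = {0..1}"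
    by (simp add: unit_interval_def space_restrict_space)
  have id: "(\<lambda>x. x) \<in> borel_measurable unit_interval"
    unfolding unit_interval_def by (rule measurable_restrict_space1) simp
  have fst: "fst \<in> borel_measurable (unit_interval \<Otimes>\<^sub>M unit_interval)"
    using measurable_comp[OF measurable_fst id, of unit_interval] by (simp add: comp_def)
  have snd: "snd \<in> borel_measurable (unit_interval \<Otimes>\<^sub>M unit_interval)"
    using measurable_comp[OF measurable_snd id, of unit_interval] by (simp add: comp_def)
  have "{p \<in> space (unit_interval \<Otimes>\<^sub>M unit_interval). fst p < snd p}
      \<in> sets (unit_interval \<Otimes>\<^sub>M unit_interval)"
    using fst snd by (rule borel_measurable_less)
  also have "{p \<in> space (unit_interval \<Otimes>\<^sub>M unit_interval). fst p < snd p} = unit_order"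
    by (auto simp: space_pair_measure sp unit_order_def)
  finally show ?thesis
    by unfold_locales
      (auto simp: sp strict_linear_order_on_def unit_order_def trans_def irrefl_def total_on_def)
qed

lemma cut_norm_bdd_above:
  assumes "prob_space M" and "(\<lambda>(x, y). W x y) \<in> borel_measurable (M \<Otimes>\<^sub>M M)"
    and bd: "\<And>x y. x \<in> space M \<Longrightarrow> y \<in> space M \<Longrightarrow> \<bar>W x y\<bar> \<le> B"
  shows "bdd_above {\<bar>\<integral>(x, y). W x y * f x * g y \<partial>(M \<Otimes>\<^sub>M M)\<bar> | f g.
       f \<in> borel_measurable M \<and> f \<in> space M \<rightarrow> {-1..1} \<and>
       g \<in> borel_measurable M \<and> g \<in> space M \<rightarrow> {-1..1::real}}"
proof -
  interpret prob_space M by fact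
  interpret P: pair_prob_space M M ..
  have "\<bar>\<integral>(x, y). W x y * f x * g y \<partial>(M \<Otimes>\<^sub>M M)\<bar> \<le> B"
    if fg: "f \<in> space M \<rightarrow> {-1..1}" "g \<in> space M \<rightarrow> {-1..1::real}" for f g
  proof -
    have le: "\<bar>W x y * f x * g y\<bar> \<le> B" if "x \<in> space M" "y \<in> space M" for x y
    proof -
      have "\<bar>f x\<bar> \<le> 1" "\<bar>g y\<bar> \<le> 1" using fg that by (auto simp: Pi_iff abs_le_iff)
      then have "\<bar>W x y\<bar> * \<bar>f x\<bar> * \<bar>g y\<bar> \<le> \<bar>W x y\<bar> * 1 * 1"
        by (intro mult_mono) auto
      then show ?thesis using bd[OF that] by (simp add: abs_mult)
    qed
    have "\<bar>\<integral>(x, y). W x y * f x * g y \<partial>(M \<Otimes>\<^sub>M M)\<bar>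
        \<le> (\<integral>p. \<bar>case p of (x, y) \<Rightarrow> W x y * f x * g y\<bar> \<partial>(M \<Otimes>\<^sub>M M))"
      by (rule integral_abs_bound)
    also have "\<dots> \<le> (\<integral>p. B \<partial>(M \<Otimes>\<^sub>M M))"
      by (rule integral_mono') (use le in \<open>auto simp: space_pair_measure intro: order_trans[OF abs_ge_zero]\<close>)
    finally show ?thesis by (simp add: P.prob_space)
  qed
  then show ?thesis by (auto intro!: bdd_aboveI[where M = B])
qed

lemma cut_norm_nonneg:
  assumes "prob_space M" and "(\<lambda>(x, y). W x y) \<in> borel_measurable (M \<Otimes>\<^sub>M M)"
    and "\<And>x y. x \<in> space M \<Longrightarrow> y \<in> space M \<Longrightarrow> \<bar>W x y\<bar> \<le> B"
  shows "0 \<le> cut_norm M W"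
  unfolding cut_norm_def
  by (rule cSup_upper2[OF _ _ cut_norm_bdd_above[OF assms]])
    (auto intro!: exI[of _ "\<lambda>_. 0"])

lemma pullback_diff:
  assumes K: "is_kernel M\<^sub>1 W\<^sub>1" "is_kernel M\<^sub>2 W\<^sub>2"
    and \<phi>: "\<phi>\<^sub>1 \<in> S \<rightarrow>\<^sub>M M\<^sub>1" "\<phi>\<^sub>2 \<in> S \<rightarrow>\<^sub>M M\<^sub>2"
  shows "(\<lambda>(x, y). pullback W\<^sub>1 \<phi>\<^sub>1 x y - pullback W\<^sub>2 \<phi>\<^sub>2 x y) \<in> borel_measurable (S \<Otimes>\<^sub>M S)"
    and "x \<in> space S \<Longrightarrow> y \<in> space S \<Longrightarrow> \<bar>pullback W\<^sub>1 \<phi>\<^sub>1 x y - pullback W\<^sub>2 \<phi>\<^sub>2 x y\<bar> \<le> 1"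
proof -
  note [measurable] = \<phi>
  have [measurable]: "(\<lambda>(x, y). W\<^sub>1 x y) \<in> borel_measurable (M\<^sub>1 \<Otimes>\<^sub>M M\<^sub>1)"
    "(\<lambda>(x, y). W\<^sub>2 x y) \<in> borel_measurable (M\<^sub>2 \<Otimes>\<^sub>M M\<^sub>2)"
    using K by (auto simp: is_kernel_def)
  have "(\<lambda>p. (case (\<phi>\<^sub>1 (fst p), \<phi>\<^sub>1 (snd p)) of (x, y) \<Rightarrow> W\<^sub>1 x y)
      - (case (\<phi>\<^sub>2 (fst p), \<phi>\<^sub>2 (snd p)) of (x, y) \<Rightarrow> W\<^sub>2 x y)) \<in> borel_measurable (S \<Otimes>\<^sub>M S)"
    by measurable
  then show "(\<lambda>(x, y). pullback W\<^sub>1 \<phi>\<^sub>1 x y - pullback W\<^sub>2 \<phi>\<^sub>2 x y) \<in> borel_measurable (S \<Otimes>\<^sub>M S)"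
    by (simp add: pullback_def split_beta')
  assume "x \<in> space S" "y \<in> space S"
  then have "\<phi>\<^sub>1 x \<in> space M\<^sub>1" "\<phi>\<^sub>1 y \<in> space M\<^sub>1" "\<phi>\<^sub>2 x \<in> space M\<^sub>2" "\<phi>\<^sub>2 y \<in> space M\<^sub>2"
    by (simp_all add: measurable_space[OF \<phi>(1)] measurable_space[OF \<phi>(2)])
  then have "W\<^sub>1 (\<phi>\<^sub>1 x) (\<phi>\<^sub>1 y) \<in> {0..1}" "W\<^sub>2 (\<phi>\<^sub>2 x) (\<phi>\<^sub>2 y) \<in> {0..1}"
    using K unfolding is_kernel_def by blast+
  then show "\<bar>pullback W\<^sub>1 \<phi>\<^sub>1 x y - pullback W\<^sub>2 \<phi>\<^sub>2 x y\<bar> \<le> 1"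
    by (auto simp: pullback_def abs_le_iff)
qed

lemma delta_cut_le:
  fixes M\<^sub>1 :: "'a measure" and M\<^sub>2 :: "'b measure" and S :: "'c measure"
  assumes K: "is_kernel M\<^sub>1 W\<^sub>1" "is_kernel M\<^sub>2 W\<^sub>2" and S: "prob_space S"
    and \<phi>: "\<phi>\<^sub>1 \<in> measure_preserving S M\<^sub>1" "\<phi>\<^sub>2 \<in> measure_preserving S M\<^sub>2"
  shows "delta_cut M\<^sub>1 W\<^sub>1 M\<^sub>2 W\<^sub>2
    \<le> cut_norm S (\<lambda>x y. pullback W\<^sub>1 \<phi>\<^sub>1 x y - pullback W\<^sub>2 \<phi>\<^sub>2 x y)"
proof -
  have m: "\<phi>\<^sub>1 \<in> S \<rightarrow>\<^sub>M M\<^sub>1" "\<phi>\<^sub>2 \<in> S \<rightarrow>\<^sub>M M\<^sub>2"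
    and d: "distr S M\<^sub>1 \<phi>\<^sub>1 = M\<^sub>1" "distr S M\<^sub>2 \<phi>\<^sub>2 = M\<^sub>2"
    using \<phi> by (auto simp: measure_preserving_def)
  note [measurable] = m
  interpret S: prob_space S by fact
  define \<phi> where "\<phi> x = (\<phi>\<^sub>1 x, \<phi>\<^sub>2 x)" for x
  have \<phi>m [measurable]: "\<phi> \<in> S \<rightarrow>\<^sub>M M\<^sub>1 \<Otimes>\<^sub>M M\<^sub>2" unfolding \<phi>_def by measurable
  define T where "T = distr S (M\<^sub>1 \<Otimes>\<^sub>M M\<^sub>2) \<phi>"
  have T: "prob_space T" unfolding T_def by (rule S.prob_space_distr) measurable
  interpret T: prob_space T by fact
  have sT [measurable_cong]: "sets T = sets (M\<^sub>1 \<Otimes>\<^sub>M M\<^sub>2)" by (simp add: T_def)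
  have \<phi>T [measurable]: "\<phi> \<in> S \<rightarrow>\<^sub>M T" by measurable
  have fstT: "fst \<in> measure_preserving T M\<^sub>1"
    using d by (auto simp: measure_preserving_def T_def distr_distr comp_def \<phi>_def)
  have sndT: "snd \<in> measure_preserving T M\<^sub>2"
    using d by (auto simp: measure_preserving_def T_def distr_distr comp_def \<phi>_def)
  have mT: "fst \<in> T \<rightarrow>\<^sub>M M\<^sub>1" "snd \<in> T \<rightarrow>\<^sub>M M\<^sub>2" by measurable
  let ?U = "\<lambda>x y. pullback W\<^sub>1 fst x y - pullback W\<^sub>2 snd x y"
  let ?V = "\<lambda>x y. pullback W\<^sub>1 \<phi>\<^sub>1 x y - pullback W\<^sub>2 \<phi>\<^sub>2 x y"
  note Um [measurable] = pullback_diff(1)[OF K mT]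
  have TT: "T \<Otimes>\<^sub>M T = distr (S \<Otimes>\<^sub>M S) (T \<Otimes>\<^sub>M T) (\<lambda>(x, y). (\<phi> x, \<phi> y))"
  proof -
    have "distr S T \<phi> = T"
      by (simp add: T_def cong: distr_cong)
    then show ?thesis
      using pair_measure_distr[OF \<phi>T \<phi>T] T.sigma_finite_measure_axioms by simp
  qed
  have "cut_norm T ?U \<le> cut_norm S ?V"
    unfolding cut_norm_def
  proof (rule cSup_subset_mono[OF _ cut_norm_bdd_above[OF S pullback_diff(1)[OF K m] pullback_diff(2)[OF K m]]])
    show "{\<bar>\<integral>(x, y). ?U x y * f x * g y \<partial>(T \<Otimes>\<^sub>M T)\<bar> | f g.
       f \<in> borel_measurable T \<and> f \<in> space T \<rightarrow> {-1..1} \<and>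
       g \<in> borel_measurable T \<and> g \<in> space T \<rightarrow> {-1..1}} \<noteq> {}"
      by (auto intro!: exI[of _ "\<lambda>_. 0"])
    show "{\<bar>\<integral>(x, y). ?U x y * f x * g y \<partial>(T \<Otimes>\<^sub>M T)\<bar> | f g.
       f \<in> borel_measurable T \<and> f \<in> space T \<rightarrow> {-1..1} \<and>
       g \<in> borel_measurable T \<and> g \<in> space T \<rightarrow> {-1..1}}
      \<subseteq> {\<bar>\<integral>(x, y). ?V x y * f x * g y \<partial>(S \<Otimes>\<^sub>M S)\<bar> | f g.
       f \<in> borel_measurable S \<and> f \<in> space S \<rightarrow> {-1..1} \<and>
       g \<in> borel_measurable S \<and> g \<in> space S \<rightarrow> {-1..1}}"
    proof clarify
      fix f g :: "'a \<times> 'b \<Rightarrow> real"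
      assume [measurable]: "f \<in> borel_measurable T" "g \<in> borel_measurable T"
        and fg: "f \<in> space T \<rightarrow> {-1..1}" "g \<in> space T \<rightarrow> {-1..1}"
      have meas: "(\<lambda>(x, y). ?U x y * f x * g y) \<in> borel_measurable (T \<Otimes>\<^sub>M T)"
      proof -
        have "(\<lambda>p. (case p of (x, y) \<Rightarrow> ?U x y) * f (fst p) * g (snd p))
            \<in> borel_measurable (T \<Otimes>\<^sub>M T)"
          by measurable
        then show ?thesis by (simp add: split_beta')
      qed
      have "(\<integral>(x, y). ?U x y * f x * g y \<partial>(T \<Otimes>\<^sub>M T))
          = (\<integral>p. (case (case p of (x, y) \<Rightarrow> (\<phi> x, \<phi> y)) of (x, y) \<Rightarrow> ?U x y * f x * g y) \<partial>(S \<Otimes>\<^sub>M S))"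
        by (subst TT, rule integral_distr[OF _ meas]) measurable
      also have "\<dots> = (\<integral>(x, y). ?V x y * f (\<phi> x) * g (\<phi> y) \<partial>(S \<Otimes>\<^sub>M S))"
        by (simp add: split_beta' pullback_def \<phi>_def)
      finally have eq: "(\<integral>(x, y). ?U x y * f x * g y \<partial>(T \<Otimes>\<^sub>M T))
          = (\<integral>(x, y). ?V x y * f (\<phi> x) * g (\<phi> y) \<partial>(S \<Otimes>\<^sub>M S))" .
      have "(\<lambda>x. f (\<phi> x)) \<in> borel_measurable S" "(\<lambda>x. g (\<phi> x)) \<in> borel_measurable S"
        by measurable
      moreover have "(\<lambda>x. f (\<phi> x)) \<in> space S \<rightarrow> {-1..1}" "(\<lambda>x. g (\<phi> x)) \<in> space S \<rightarrow> {-1..1}"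
        using fg measurable_space[OF \<phi>T] by (auto simp: Pi_iff)
      ultimately show "\<exists>f' g'. \<bar>\<integral>(x, y). ?U x y * f x * g y \<partial>(T \<Otimes>\<^sub>M T)\<bar>
          = \<bar>\<integral>(x, y). ?V x y * f' x * g' y \<partial>(S \<Otimes>\<^sub>M S)\<bar> \<and>
          f' \<in> borel_measurable S \<and> f' \<in> space S \<rightarrow> {-1..1} \<and>
          g' \<in> borel_measurable S \<and> g' \<in> space S \<rightarrow> {-1..1}"
        using eq by (intro exI[of _ "\<lambda>x. f (\<phi> x)"] exI[of _ "\<lambda>x. g (\<phi> x)"]) simp
    qed
  qed
  moreover have "delta_cut M\<^sub>1 W\<^sub>1 M\<^sub>2 W\<^sub>2 \<le> cut_norm T ?U"
    unfolding delta_cut_def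
  proof (rule cInf_lower)
    show "cut_norm T ?U \<in> {cut_norm S (\<lambda>x y. pullback W\<^sub>1 \<phi>\<^sub>1 x y - pullback W\<^sub>2 \<phi>\<^sub>2 x y)
       | (S :: ('a \<times> 'b) measure) \<phi>\<^sub>1 \<phi>\<^sub>2.
       prob_space S \<and> \<phi>\<^sub>1 \<in> measure_preserving S M\<^sub>1 \<and> \<phi>\<^sub>2 \<in> measure_preserving S M\<^sub>2}"
      using T fstT sndT by blast
    show "bdd_below {cut_norm S (\<lambda>x y. pullback W\<^sub>1 \<phi>\<^sub>1 x y - pullback W\<^sub>2 \<phi>\<^sub>2 x y)
       | (S :: ('a \<times> 'b) measure) \<phi>\<^sub>1 \<phi>\<^sub>2.
       prob_space S \<and> \<phi>\<^sub>1 \<in> measure_preserving S M\<^sub>1 \<and> \<phi>\<^sub>2 \<in> measure_preserving S M\<^sub>2}"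
      by (rule bdd_belowI[where m = 0])
        (auto simp: measure_preserving_def intro!: cut_norm_nonneg pullback_diff[OF K])
  qed
  ultimately show ?thesis by linarith
qed

end

theory Submission
  imports Defs
begin

text \<open>
  Adding an independent uniform coordinate, ordered lexicographically, removes the atoms of \<open>M\<close>.
  On an atomless ordered space the map \<open>F x = \<mu> {y. y \<prec> x}\<close> is uniformly distributed, and
  \<open>G s t = sup {W x y | F x < s, F y < t}\<close> is a Borel monotone kernel with
  \<open>G (F x) (F y) \<le> W x y \<le> G (F x + h) (F y + h)\<close>. Translating a \<open>[0,1]\<close>-valued function by \<open>h\<close>
  changes its integral by at most \<open>h\<close> per coordinate, so \<open>W\<close> and the pullback of \<open>G\<close> along \<open>F\<close>
  agree almost everywhere.
\<close>

section \<open>Measure-preserving maps\<close>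

text \<open>Almost everywhere equality of the pullbacks settles the first conjunct. The second asks
  that \<open>W\<close> and \<open>G\<close> have the same equivalence class over an arbitrary
  carrier type \<open>'c\<close>, which amounts to instances of the triangle inequality for
  \<open>delta_cut\<close>. Composing couplings along a common marginal usually rests on
  disintegration, which can fail on a bare measurable space. Both compositions therefore use
  explicit densities on product spaces. From \<open>W\<close> to \<open>G\<close> an independent
  uniform coordinate is attached. From \<open>G\<close> to \<open>W\<close> two uniform variables
  are only forced into the same short interval, and the error is paid for by the same translation
  estimate that serves the representation. A second obstacle is that orders can be long. Under the
  continuum hypothesis \<open>[0,1]\<close> has a well-order with countable initial segments, for
  which \<open>F\<close> vanishes identically. The Fubini argument for measurable orders is what
  excludes this.\<close>

lemma measure_preserving_comp:
  assumes "f \<in> measure_preserving A B" "g \<in> measure_preserving B C"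
  shows "(\<lambda>x. g (f x)) \<in> measure_preserving A C"
proof -
  have [measurable]: "f \<in> A \<rightarrow>\<^sub>M B" "g \<in> B \<rightarrow>\<^sub>M C" and d: "distr A B f = B" "distr B C g = C"
    using assms by (auto simp: measure_preserving_def)
  have "distr A C (g \<circ> f) = distr (distr A B f) C g" by (rule distr_distr[symmetric]) measurable
  then show ?thesis using d by (simp add: measure_preserving_def comp_def)
qed

lemma measure_preserving_pair:
  assumes "prob_space S" "prob_space T" and \<phi>: "\<phi> \<in> measure_preserving S T"
  shows "(\<lambda>(x, y). (\<phi> x, \<phi> y)) \<in> measure_preserving (S \<Otimes>\<^sub>M S) (T \<Otimes>\<^sub>M T)"
proof -
  interpret T: prob_space T by fact
  have [measurable]: "\<phi> \<in> S \<rightarrow>\<^sub>M T" and d: "distr S T \<phi> = T"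
    using \<phi> by (auto simp: measure_preserving_def)
  show ?thesis
    using pair_measure_distr[of \<phi> S T \<phi> S T] T.sigma_finite_measure_axioms d
    by (simp add: measure_preserving_def)
qed

lemma integral_measure_preserving:
  fixes f :: "_ \<Rightarrow> real"
  assumes "\<phi> \<in> measure_preserving S T" "f \<in> borel_measurable T"
  shows "(\<integral>x. f (\<phi> x) \<partial>S) = (\<integral>x. f x \<partial>T)"
  using integral_distr[of \<phi> S T f] assms by (simp add: measure_preserving_def)

lemma AE_measure_preserving:
  assumes "\<phi> \<in> measure_preserving S T" "AE x in T. P x"
  shows "AE x in S. P (\<phi> x)"
proof (rule AE_distrD[of \<phi> S T P])
  show "\<phi> \<in> S \<rightarrow>\<^sub>M T" using assms(1) by (simp add: measure_preserving_def)
  have "distr S T \<phi> = T" using assms(1) by (simp add: measure_preserving_def)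
  then show "AE x in distr S T \<phi>. P x" using assms(2) by (simp only: )
qed

lemma nn_integral_measure_preserving:
  assumes "\<phi> \<in> measure_preserving S T" "f \<in> borel_measurable T"
  shows "(\<integral>\<^sup>+x. f (\<phi> x) \<partial>S) = (\<integral>\<^sup>+x. f x \<partial>T)"
  using nn_integral_distr[of \<phi> S T f] assms by (simp add: measure_preserving_def)

section \<open>The unit interval and uniformly distributed functions\<close>

lemma space_unit_interval [simp]: "space unit_interval = {0..1}"
  by (simp add: unit_interval_def space_restrict_space)

lemma prob_space_unit_interval: "prob_space unit_interval"
  using ordered_prob_space_unit_interval by (simp add: ordered_prob_space_def)

lemma measurable_unit_interval_ident [measurable]: "(\<lambda>x. x) \<in> borel_measurable unit_interval"
  unfolding unit_interval_def by (rule measurable_restrict_space1) simp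

lemma measurable_unit_interval_real: "f \<in> M \<rightarrow>\<^sub>M unit_interval \<Longrightarrow> f \<in> borel_measurable M"
  using measurable_compose[OF _ measurable_unit_interval_ident] by simp

lemma emeasure_unit_interval:
  assumes "A \<in> sets borel" "A \<subseteq> {0..1}" shows "emeasure unit_interval A = emeasure lborel A"
  unfolding unit_interval_def using assms by (intro emeasure_restrict_space) auto

lemma measure_unit_interval:
  assumes "A \<in> sets borel" "A \<subseteq> {0..1}" shows "measure unit_interval A = measure lborel A"
  using emeasure_unit_interval[OF assms] by (simp add: measure_def)

lemma null_sets_unit_interval_singleton:
  assumes "u \<in> {0..1}" shows "{u} \<in> null_sets unit_interval"
proof -
  have "{u} \<in> sets unit_interval"
    using assms by (auto simp: unit_interval_def sets_restrict_space intro!: image_eqI[where x = "{u}"])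
  then show ?thesis using assms by (simp add: null_sets_def emeasure_unit_interval)
qed

lemma AE_unit_interval_less_1: "AE t in unit_interval. t < 1"
  by (rule AE_I'[OF null_sets_unit_interval_singleton[of 1]]) auto

text \<open>A distribution on the reals is determined by its distribution function, so both measures
  are pushed to \<open>borel\<close> and compared there. The equality transfers back because
  measurable sets of \<open>unit_interval\<close> are Borel subsets of
  \<open>{0..1}\<close>.\<close>

lemma measure_preserving_unit_intervalI:
  assumes "prob_space M" and F [measurable]: "F \<in> borel_measurable M"
    and F01: "\<And>x. x \<in> space M \<Longrightarrow> F x \<in> {0..1}"
    and cdf: "\<And>t. 0 \<le> t \<Longrightarrow> t \<le> 1 \<Longrightarrow> measure M {x \<in> space M. F x \<le> t} = t"
  shows "F \<in> measure_preserving M unit_interval"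
proof -
  interpret M: prob_space M by fact
  interpret I: prob_space unit_interval by (rule prob_space_unit_interval)
  have Fm: "F \<in> M \<rightarrow>\<^sub>M unit_interval"
    unfolding unit_interval_def by (rule measurable_restrict_space2) (use F01 in auto)
  let ?D = "distr M borel F" and ?U = "distr unit_interval borel (\<lambda>x. x)"
  have "?D = ?U"
  proof (rule cdf_unique)
    show "real_distribution ?D" by (rule M.real_distribution_distr) fact
    show "real_distribution ?U" by (rule I.real_distribution_distr) measurable
    show "cdf ?D = cdf ?U"
    proof
      fix t :: real
      have D: "cdf ?D t = measure M {x \<in> space M. F x \<le> t}"
        by (auto simp: cdf_def measure_distr intro!: arg_cong[where f = "measure M"])
      have U: "cdf ?U t = measure unit_interval ({..t} \<inter> {0..1})"
        by (simp add: cdf_def measure_distr)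
      consider "t < 0" | "0 \<le> t" "t \<le> 1" | "t > 1" by linarith
      then show "cdf ?D t = cdf ?U t"
      proof cases
        case 1
        have "{x \<in> space M. F x \<le> t} = {}" "{..t} \<inter> {0..1} = {}" using 1 F01 by fastforce+
        then show ?thesis unfolding D U by (simp only: measure_empty)
      next
        case 2
        have "{..t} \<inter> {0..1} = {0..t}" using 2 by auto
        then show ?thesis unfolding D U using 2 cdf by (simp add: measure_unit_interval)
      next
        case 3
        have "{x \<in> space M. F x \<le> t} = space M" "{..t} \<inter> {0..1} = space unit_interval"
          using 3 F01 by fastforce+
        then show ?thesis unfolding D U by (simp only: M.prob_space I.prob_space)
      qed
    qed
  qed
  have "distr M unit_interval F = unit_interval"
  proof (rule measure_eqI)
    fix A assume "A \<in> sets (distr M unit_interval F)"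
    then have AI: "A \<in> sets unit_interval" by simp
    then have A: "A \<in> sets borel" "A \<subseteq> {0..1}"
      by (auto simp: unit_interval_def sets_restrict_space)
    have "emeasure (distr M unit_interval F) A = emeasure ?D A"
      using AI A Fm by (simp add: emeasure_distr)
    also have "\<dots> = emeasure unit_interval A"
      unfolding \<open>?D = ?U\<close> using A by (simp add: emeasure_distr Int_absorb2)
    finally show "emeasure (distr M unit_interval F) A = emeasure unit_interval A" .
  qed simp
  then show ?thesis using Fm by (simp add: measure_preserving_def)
qed

section \<open>The distribution function of an ordered probability space\<close>

context ordered_prob_space
begin

definition below :: "'a \<Rightarrow> 'a set" where
  "below x = {y \<in> space M. (y, x) \<in> r}"

definition order_cdf :: "'a \<Rightarrow> real" where
  "order_cdf x = prob (below x)"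

lemma order_trans_rel: "(x, y) \<in> r \<Longrightarrow> (y, z) \<in> r \<Longrightarrow> (x, z) \<in> r"
  using strict_linear_order unfolding strict_linear_order_on_def trans_def by blast

lemma order_irrefl: "(x, x) \<notin> r"
  using strict_linear_order unfolding strict_linear_order_on_def irrefl_def by blast

lemma order_cases:
  assumes "x \<in> space M" "y \<in> space M"
  obtains "(x, y) \<in> r" | "x = y" | "(y, x) \<in> r"
  using assms strict_linear_order unfolding strict_linear_order_on_def total_on_def by blast

lemma order_pred: "Measurable.pred (M \<Otimes>\<^sub>M M) (\<lambda>p. (fst p, snd p) \<in> r)"
  using measurable_order by simp

lemma measurable_order_pred [measurable (raw)]:
  assumes [measurable]: "f \<in> N \<rightarrow>\<^sub>M M" "g \<in> N \<rightarrow>\<^sub>M M"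
  shows "Measurable.pred N (\<lambda>x. (f x, g x) \<in> r)"
  using measurable_compose[OF _ order_pred, of "\<lambda>x. (f x, g x)" N] by simp

text \<open>The diagonal of a general measurable space need not be measurable. Here totality makes
  it the complement of \<open>r\<close> and its converse, and measurable singletons follow.\<close>

lemma measurable_order_eq [measurable (raw)]:
  assumes [measurable]: "f \<in> N \<rightarrow>\<^sub>M M" "g \<in> N \<rightarrow>\<^sub>M M"
  shows "Measurable.pred N (\<lambda>x. f x = g x)"
proof -
  have "Measurable.pred N (\<lambda>x. (f x, g x) \<notin> r \<and> (g x, f x) \<notin> r)" by measurable
  also have "?this \<longleftrightarrow> ?thesis"
  proof (rule measurable_cong)
    fix x assume "x \<in> space N"
    then have "f x \<in> space M" "g x \<in> space M" by (auto intro: measurable_space)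
    then show "((f x, g x) \<notin> r \<and> (g x, f x) \<notin> r) = (f x = g x)"
      using order_cases order_irrefl by metis
  qed
  finally show ?thesis .
qed

lemma sets_below [measurable]: "x \<in> space M \<Longrightarrow> below x \<in> sets M"
  unfolding below_def by measurable

lemma sets_above [measurable]: "x \<in> space M \<Longrightarrow> {y \<in> space M. (x, y) \<in> r} \<in> sets M"
  by measurable

lemma sets_singleton:
  assumes "x \<in> space M" shows "{x} \<in> sets M"
proof -
  have "{y \<in> space M. y = x} \<in> sets M" using assms by measurable
  also have "{y \<in> space M. y = x} = {x}" using assms by auto
  finally show ?thesis .
qed

lemma below_mono: "(x, y) \<in> r\<^sup>= \<Longrightarrow> below x \<subseteq> below y"
  by (auto simp: below_def intro: order_trans_rel)

lemma order_cdf_mono: "y \<in> space M \<Longrightarrow> (x, y) \<in> r\<^sup>= \<Longrightarrow> order_cdf x \<le> order_cdf y"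
  unfolding order_cdf_def by (intro finite_measure_mono below_mono sets_below)

text \<open>Distinct points may share a value of \<open>order_cdf\<close>, so only strict
  inequalities of values can be lifted back to the order. This dictates the strict inequalities in
  the construction of \<open>G\<close>.\<close>

lemma order_cdf_less_imp:
  assumes "x \<in> space M" "y \<in> space M" "order_cdf x < order_cdf y"
  shows "(x, y) \<in> r"
  using assms order_cdf_mono[of x y] by (metis order_cases order_cdf_mono UnI1 leD less_irrefl)

lemma measurable_order_cdf [measurable]: "order_cdf \<in> borel_measurable M"
  unfolding order_cdf_def below_def by measurable

lemma order_cdf_bounds: "order_cdf x \<in> {0..1}"
  by (auto simp: order_cdf_def)

text \<open>Reversing the order turns an upper bound for the law of \<open>order_cdf\<close> into
  the matching lower bound.\<close>

lemma converse_ordered_prob_space: "ordered_prob_space M (r\<inverse>)"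
proof
  show "strict_linear_order_on (space M) (r\<inverse>)"
    using strict_linear_order unfolding strict_linear_order_on_def by simp
  have "{p \<in> space (M \<Otimes>\<^sub>M M). (snd p, fst p) \<in> r} \<in> sets (M \<Otimes>\<^sub>M M)" by measurable
  also have "{p \<in> space (M \<Otimes>\<^sub>M M). (snd p, fst p) \<in> r} = r\<inverse>"
    using sets.sets_into_space[OF measurable_order] by (auto simp: space_pair_measure)
  finally show "r\<inverse> \<in> sets (M \<Otimes>\<^sub>M M)" .
qed

end

section \<open>Uniformity of the distribution function of an atomless order\<close>

locale atomless_ordered_prob_space = ordered_prob_space +
  assumes atomless: "x \<in> space M \<Longrightarrow> prob {x} = 0"
begin

lemma converse_atomless: "atomless_ordered_prob_space M (r\<inverse>)"
  using converse_ordered_prob_space atomless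
  by (simp add: atomless_ordered_prob_space_def atomless_ordered_prob_space_axioms_def)

lemma prob_above_Int:
  assumes x: "x \<in> space M" and [measurable]: "E \<in> sets M"
  shows "prob ({y \<in> space M. (x, y) \<in> r} \<inter> E) = prob E - prob (below x \<inter> E)"
proof -
  let ?A = "{y \<in> space M. (x, y) \<in> r}"
  have [measurable]: "?A \<in> sets M" "below x \<in> sets M" "{x} \<in> sets M"
    using x by (auto intro: sets_singleton sets_above sets_below)
  have "E = (?A \<inter> E) \<union> (below x \<inter> E) \<union> ({x} \<inter> E)"
    using sets.sets_into_space[OF assms(2)] x by (auto simp: below_def elim: order_cases)
  then have "prob E = prob ((?A \<inter> E) \<union> (below x \<inter> E) \<union> ({x} \<inter> E))" by simp
  also have "\<dots> = prob (?A \<inter> E) + prob (below x \<inter> E) + prob ({x} \<inter> E)"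
  proof -
    have "?A \<inter> E \<in> sets M" "below x \<inter> E \<in> sets M" "{x} \<inter> E \<in> sets M" by measurable
    moreover have "(?A \<inter> E) \<inter> (below x \<inter> E) = {}" "(?A \<inter> E \<union> below x \<inter> E) \<inter> ({x} \<inter> E) = {}"
      by (auto simp: below_def order_irrefl dest: order_trans_rel)
    ultimately show ?thesis by (simp only: finite_measure_Union sets.Un)
  qed
  also have "prob ({x} \<inter> E) = 0"
    using atomless[OF x] finite_measure_mono[of "{x} \<inter> E" "{x}"] by (simp add: measure_le_0_iff)
  finally show ?thesis by simp
qed

text \<open>Measurability of the order enters here: integrating the measures of the initial segments of
  \<open>E\<close> gives, by Fubini and symmetry, half of the square of the measure of \<open>E\<close>.\<close>

lemma prob_le_twice_initial_segment:
  assumes E [measurable]: "E \<in> sets M" and c: "0 \<le> c"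
    and le: "\<And>x. x \<in> E \<Longrightarrow> prob (below x \<inter> E) \<le> c"
  shows "prob E \<le> 2 * c"
proof -
  interpret P: pair_prob_space M M ..
  \<comment> \<open>The indicator of the increasing pairs in \<open>E\<close>. Integrating out the
    smaller point leaves an initial segment of \<open>E\<close>; integrating out the larger one
    leaves its complement in \<open>E\<close>, up to a null point.\<close>
  let ?R = "\<lambda>x y. indicator {p \<in> space (M \<Otimes>\<^sub>M M). fst p \<in> E \<and> snd p \<in> E \<and> (fst p, snd p) \<in> r} (x, y) :: real"
  have m: "(\<lambda>(x, y). ?R x y) \<in> borel_measurable (M \<Otimes>\<^sub>M M)" by measurable
  have "integrable (M \<Otimes>\<^sub>M M) (\<lambda>(x, y). ?R x y)"
    by (rule P.integrable_const_bound[where B = 1]) (use m in auto)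
  from P.Fubini_integral[OF this]
  have fub: "(\<integral>y. (\<integral>x. ?R x y \<partial>M) \<partial>M) = (\<integral>x. (\<integral>y. ?R x y \<partial>M) \<partial>M)" .
  have l: "(\<integral>x. ?R x y \<partial>M) = indicator E y * prob (below y \<inter> E)" if y: "y \<in> space M" for y
  proof -
    have "(\<integral>x. ?R x y \<partial>M) = (\<integral>x. indicator E y * indicator (below y \<inter> E) x \<partial>M)"
      by (rule Bochner_Integration.integral_cong)
        (use y in \<open>auto simp: indicator_def space_pair_measure below_def\<close>)
    then show ?thesis using y by simp
  qed
  have r: "(\<integral>y. ?R x y \<partial>M) = indicator E x * (prob E - prob (below x \<inter> E))" if x: "x \<in> space M" for x
  proof -
    have "(\<integral>y. ?R x y \<partial>M) = (\<integral>y. indicator E x * indicator ({y \<in> space M. (x, y) \<in> r} \<inter> E) y \<partial>M)"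
      by (rule Bochner_Integration.integral_cong)
        (use x in \<open>auto simp: indicator_def space_pair_measure below_def\<close>)
    then show ?thesis using x prob_above_Int[OF x E] sets_above[OF x] by simp
  qed
  let ?p = "\<lambda>x. indicator E x * prob (below x \<inter> E)"
  have bm [measurable]: "(\<lambda>x. prob (below x \<inter> E)) \<in> borel_measurable M"
  proof -
    have "(\<lambda>x. prob {y \<in> space M. (y, x) \<in> r \<and> y \<in> E}) \<in> borel_measurable M" by measurable
    then show ?thesis by (simp add: below_def Int_def conj_ac)
  qed
  have ip: "integrable M ?p"
    by (rule integrable_const_bound[where B = 1]) (auto simp: indicator_def)
  have iE: "integrable M (\<lambda>x. indicator E x * d)" for d :: real
    by (intro integrable_mult_left integrable_real_indicator) (auto simp: emeasure_eq_measure)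
  have "(\<integral>x. ?p x \<partial>M) = (\<integral>y. (\<integral>x. ?R x y \<partial>M) \<partial>M)"
    by (rule Bochner_Integration.integral_cong) (simp_all only: l)
  also have "\<dots> = (\<integral>x. indicator E x * (prob E - prob (below x \<inter> E)) \<partial>M)"
    unfolding fub by (rule Bochner_Integration.integral_cong) (simp_all only: r)
  also have "\<dots> = (\<integral>x. indicator E x * prob E - ?p x \<partial>M)" by (simp add: algebra_simps)
  also have "\<dots> = prob E * prob E - (\<integral>x. ?p x \<partial>M)"
    using ip iE by (subst Bochner_Integration.integral_diff) auto
  finally have "prob E * prob E = 2 * (\<integral>x. ?p x \<partial>M)" by simp
  moreover have "(\<integral>x. ?p x \<partial>M) \<le> (\<integral>x. indicator E x * c \<partial>M)"
    by (rule integral_mono[OF ip iE]) (auto simp: indicator_def le)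
  ultimately have "prob E * prob E \<le> prob E * (2 * c)" by simp
  \<comment> \<open>One factor \<open>prob E\<close> cancels; if it is zero, the claim is just
    \<open>0 \<le> c\<close>.\<close>
  then show ?thesis
    using c by (cases "prob E = 0") (auto simp: mult_le_cancel_left dest: order.antisym[OF measure_nonneg])
qed

text \<open>The set need not be a countable union of initial segments \<open>below x\<close>, so
  continuity of the measure does not suffice. Instead it is cut at a point whose
  \<open>order_cdf\<close> is nearly the supremum over the set: the part from that point on has only
  short initial segments, hence is small.\<close>

lemma prob_order_cdf_le:
  assumes t: "0 \<le> t" shows "prob {x \<in> space M. order_cdf x \<le> t} \<le> t"
proof (cases "{x \<in> space M. order_cdf x \<le> t} = {}")
  case True
  then show ?thesis using t by (simp only: measure_empty)
next
  case False
  let ?A = "{x \<in> space M. order_cdf x \<le> t}"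
  define s where "s = (SUP x\<in>?A. order_cdf x)"
  have bdd: "bdd_above (order_cdf ` ?A)" by (auto intro!: bdd_aboveI[where M = t])
  have st: "s \<le> t" unfolding s_def using False by (intro cSUP_least) auto
  have "prob ?A \<le> t + e" if "e > 0" for e
  proof -
    obtain x\<^sub>0 where x0: "x\<^sub>0 \<in> ?A" "s - e/2 < order_cdf x\<^sub>0"
      using less_cSUP_iff[OF False bdd, of "s - e/2"] \<open>e > 0\<close> by (auto simp: s_def)
    let ?E = "?A - below x\<^sub>0"
    have [measurable]: "below x\<^sub>0 \<in> sets M" using x0 by (auto intro: sets_below)
    \<comment> \<open>The margin \<open>e/2\<close> in the choice of the cutting point absorbs this
      factor 2, so the remainder has measure below \<open>e\<close>.\<close>
    have "prob ?E \<le> 2 * (s - order_cdf x\<^sub>0)"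
    proof (rule prob_le_twice_initial_segment)
      show "?E \<in> sets M" by measurable
      show "0 \<le> s - order_cdf x\<^sub>0" using cSUP_upper[OF x0(1) bdd] by (simp add: s_def)
    next
      fix x assume x: "x \<in> ?E"
      then have "(x\<^sub>0, x) \<in> r\<^sup>=" using x0(1) by (auto simp: below_def elim: order_cases)
      then have sub: "below x\<^sub>0 \<subseteq> below x" by (rule below_mono)
      have "prob (below x \<inter> ?E) \<le> prob (below x - below x\<^sub>0)"
        using x by (intro finite_measure_mono) (auto intro: sets_below)
      also have "\<dots> = order_cdf x - order_cdf x\<^sub>0"
        unfolding order_cdf_def using x sub by (intro finite_measure_Diff) (auto intro: sets_below)
      also have "\<dots> \<le> s - order_cdf x\<^sub>0"
        using cSUP_upper[OF _ bdd, of x] x by (simp add: s_def)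
      finally show "prob (below x \<inter> ?E) \<le> s - order_cdf x\<^sub>0" .
    qed
    moreover have "prob ?A \<le> prob (below x\<^sub>0) + prob ?E"
    proof -
      have "prob ?A \<le> prob (below x\<^sub>0 \<union> ?E)" by (intro finite_measure_mono) auto
      also have "\<dots> \<le> prob (below x\<^sub>0) + prob ?E" by (rule measure_Un_le) measurable
      finally show ?thesis .
    qed
    ultimately show ?thesis using x0 st by (simp add: order_cdf_def)
  qed
  then show ?thesis by (rule field_le_epsilon)
qed

lemma prob_order_cdf:
  assumes t: "0 \<le> t" "t \<le> 1" shows "prob {x \<in> space M. order_cdf x \<le> t} = t"
proof (rule antisym)
  show "prob {x \<in> space M. order_cdf x \<le> t} \<le> t" by (rule prob_order_cdf_le[OF t(1)])
  \<comment> \<open>Without atoms the reversed order has distribution function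
    \<open>1 - order_cdf\<close>, so the upper bound for it at \<open>1 - t\<close> bounds the
    probability that \<open>order_cdf\<close> exceeds \<open>t\<close>.\<close>
  interpret C: atomless_ordered_prob_space M "r\<inverse>" by (rule converse_atomless)
  have C: "C.order_cdf x = 1 - order_cdf x" if "x \<in> space M" for x
    using prob_above_Int[OF that sets.top] sets.sets_into_space[OF sets_below[OF that]]
      sets.sets_into_space[OF sets_above[OF that]]
    by (simp add: C.order_cdf_def C.below_def order_cdf_def prob_space Int_absorb2)
  have "prob {x \<in> space M. order_cdf x > t} \<le> prob {x \<in> space M. C.order_cdf x \<le> 1 - t}"
    using C by (intro finite_measure_mono) auto
  also have "\<dots> \<le> 1 - t" using t by (intro C.prob_order_cdf_le) auto
  finally have "prob {x \<in> space M. \<not> order_cdf x \<le> t} \<le> 1 - t" by (simp add: not_le)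
  then show "t \<le> prob {x \<in> space M. order_cdf x \<le> t}" by (subst (asm) prob_neg) auto
qed

end

context atomless_ordered_prob_space
begin

lemma order_cdf_measure_preserving: "order_cdf \<in> measure_preserving M unit_interval"
  by (rule measure_preserving_unit_intervalI)
    (use prob_space_axioms order_cdf_bounds prob_order_cdf in auto)

lemma order_cdf_dense:
  assumes "0 \<le> a" "a < 1" "a < b"
  obtains x where "x \<in> space M" "a < order_cdf x" "order_cdf x < b"
proof -
  \<comment> \<open>Values of \<open>order_cdf\<close> need not fill an interval, but a uniform law
    charges the range from \<open>a\<close> to \<open>?c\<close>. The midpoint stays strictly below
    \<open>b\<close>, and the cap at 1 keeps \<open>prob_order_cdf\<close> applicable.\<close>
  let ?c = "min ((a + b) / 2) 1"
  have "prob {x \<in> space M. order_cdf x \<le> a} < prob {x \<in> space M. order_cdf x \<le> ?c}"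
    using assms by (subst (1 2) prob_order_cdf) auto
  then have "\<not> {x \<in> space M. order_cdf x \<le> ?c} \<subseteq> {x \<in> space M. order_cdf x \<le> a}"
    using finite_measure_mono[of "{x \<in> space M. order_cdf x \<le> ?c}" "{x \<in> space M. order_cdf x \<le> a}"]
    by (auto simp: not_le)
  then obtain x where "x \<in> space M" "order_cdf x \<le> ?c" "\<not> order_cdf x \<le> a" by blast
  then show thesis using that assms by auto
qed

end

section \<open>Removing atoms by a uniform coordinate\<close>

context ordered_prob_space
begin

definition lex_order :: "('a \<times> real) rel" where
  "lex_order = {p \<in> space ((M \<Otimes>\<^sub>M unit_interval) \<Otimes>\<^sub>M (M \<Otimes>\<^sub>M unit_interval)).
     (fst (fst p), fst (snd p)) \<in> r \<or> fst (fst p) = fst (snd p) \<and> snd (fst p) < snd (snd p)}"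

lemma lex_order_iff:
  "(p, q) \<in> lex_order \<longleftrightarrow> p \<in> space (M \<Otimes>\<^sub>M unit_interval) \<and> q \<in> space (M \<Otimes>\<^sub>M unit_interval) \<and>
     ((fst p, fst q) \<in> r \<or> fst p = fst q \<and> snd p < snd q)"
  by (auto simp: lex_order_def space_pair_measure)

lemma atomless_lex_order: "atomless_ordered_prob_space (M \<Otimes>\<^sub>M unit_interval) lex_order"
proof -
  interpret I: prob_space unit_interval by (rule prob_space_unit_interval)
  interpret P: pair_prob_space M unit_interval ..
  show ?thesis
  proof
    show "strict_linear_order_on (space (M \<Otimes>\<^sub>M unit_interval)) lex_order"
      unfolding strict_linear_order_on_def
    proof (intro conjI)
      show "trans lex_order"
        by (rule transI) (auto simp: lex_order_iff intro: order_trans_rel)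
      show "irrefl lex_order" by (auto simp: irrefl_def lex_order_iff order_irrefl)
      show "total_on (space (M \<Otimes>\<^sub>M unit_interval)) lex_order"
        by (auto simp: total_on_def lex_order_iff space_pair_measure elim: order_cases)
    qed
    have [measurable]: "snd \<in> borel_measurable (M \<Otimes>\<^sub>M unit_interval)"
      by (rule measurable_unit_interval_real) measurable
    show "lex_order \<in> sets ((M \<Otimes>\<^sub>M unit_interval) \<Otimes>\<^sub>M (M \<Otimes>\<^sub>M unit_interval))"
      unfolding lex_order_def by measurable
    fix p assume "p \<in> space (M \<Otimes>\<^sub>M unit_interval)"
    then obtain x u where p: "p = (x, u)" "x \<in> space M" "u \<in> {0..1}"
      by (auto simp: space_pair_measure)
    have "emeasure (M \<Otimes>\<^sub>M unit_interval) ({x} \<times> {u}) = 0"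
      using sets_singleton[OF p(2)] null_sets_unit_interval_singleton[OF p(3)]
      by (subst I.emeasure_pair_measure_Times) (auto simp: null_sets_def)
    then show "P.prob {p} = 0" using p(1) by (simp add: measure_def)
  qed
qed

end

section \<open>Monotone kernels as pullbacks from the unit interval\<close>

text \<open>The integrals of \<open>g\<close> run over the windows \<open>{h..1 + h}\<close> and
  \<open>{0..1}\<close>. Points covered only by the first lie in \<open>{1..1 + h}\<close>, where
  \<open>g\<close> is at most 1; points covered only by the second contribute with a negative
  sign.\<close>

lemma integral_shift_le:
  fixes g :: "real \<Rightarrow> real"
  assumes [measurable]: "g \<in> borel_measurable borel" and g01: "\<And>t. g t \<in> {0..1}" and h: "0 \<le> h"
  shows "(\<integral>t. g (t + h) - g t \<partial>unit_interval) \<le> h"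
proof -
  let ?i = "\<lambda>a b t. indicator {a..b} t * g t"
  have i: "integrable lborel (?i a b)" for a b
    by (rule Bochner_Integration.integrable_bound[of _ "indicator {a..b} :: real \<Rightarrow> real"])
      (use g01 in \<open>auto simp: indicator_def emeasure_lborel_Icc_eq\<close>)
  have i': "integrable lborel (\<lambda>t. indicator {0..1} t * g (t + h))"
    by (rule Bochner_Integration.integrable_bound[of _ "indicator {0..1} :: real \<Rightarrow> real"])
      (use g01 in \<open>auto simp: indicator_def emeasure_lborel_Icc_eq\<close>)
  have "(\<integral>t. g (t + h) - g t \<partial>unit_interval)
      = (\<integral>t. indicator {0..1} t * g (t + h) - ?i 0 1 t \<partial>lborel)"
    unfolding unit_interval_def
    by (subst integral_restrict_space) (auto intro!: Bochner_Integration.integral_cong simp: indicator_def)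
  also have "\<dots> = (\<integral>t. indicator {0..1} t * g (t + h) \<partial>lborel) - (\<integral>t. ?i 0 1 t \<partial>lborel)"
    by (rule Bochner_Integration.integral_diff[OF i' i])
  also have "(\<integral>t. indicator {0..1} t * g (t + h) \<partial>lborel) = (\<integral>t. ?i h (1 + h) t \<partial>lborel)"
    using lborel_integral_real_affine[of 1 "?i h (1 + h)" h]
    by (auto intro!: Bochner_Integration.integral_cong simp: indicator_def add.commute)
  also have "\<dots> - (\<integral>t. ?i 0 1 t \<partial>lborel) = (\<integral>t. ?i h (1 + h) t - ?i 0 1 t \<partial>lborel)"
    by (rule Bochner_Integration.integral_diff[OF i i, symmetric])
  also have "\<dots> \<le> (\<integral>t. indicator {1..1 + h} t \<partial>lborel)"
  proof (rule integral_mono)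
    fix t
    show "?i h (1 + h) t - ?i 0 1 t \<le> indicator {1..1 + h} t"
      using g01[of t] h by (auto simp: indicator_def)
  qed (use i h in \<open>auto intro!: Bochner_Integration.integrable_diff simp: emeasure_lborel_Icc_eq\<close>)
  also have "\<dots> = h" using h by simp
  finally show ?thesis .
qed

text \<open>Kernels on the whole plane, so that translates of \<open>G\<close> need no truncation at
  the border of the unit square.\<close>

locale real_monotone_kernel =
  fixes G :: "real \<Rightarrow> real \<Rightarrow> real"
  assumes measurable_uncurried: "(\<lambda>p. G (fst p) (snd p)) \<in> borel_measurable borel"
    and mono: "s \<le> s' \<Longrightarrow> t \<le> t' \<Longrightarrow> G s t \<le> G s' t'"
    and range: "G s t \<in> {0..1}"
    and sym: "G s t = G t s"
begin

lemma measurable_G [measurable (raw)]: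
  assumes [measurable]: "f \<in> borel_measurable N" "g \<in> borel_measurable N"
  shows "(\<lambda>x. G (f x) (g x)) \<in> borel_measurable N"
  using measurable_compose[OF _ measurable_uncurried, of "\<lambda>x. (f x, g x)" N] by simp

lemma monotone_kernel_unit_interval: "monotone_kernel unit_interval unit_order G"
proof -
  have [measurable]: "fst \<in> borel_measurable (unit_interval \<Otimes>\<^sub>M unit_interval)"
    "snd \<in> borel_measurable (unit_interval \<Otimes>\<^sub>M unit_interval)"
    by (rule measurable_unit_interval_real; measurable)+
  have "(\<lambda>(x, y). G x y) \<in> borel_measurable (unit_interval \<Otimes>\<^sub>M unit_interval)"
    unfolding split_beta' by measurable
  then show ?thesis
    using mono range sym by (auto simp: monotone_kernel_def is_kernel_def unit_order_def)
qed

lemma abs_diff_le_1: "\<bar>G s t - G s' t'\<bar> \<le> 1"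
  using range[of s t] range[of s' t'] by (auto simp: abs_le_iff)

lemma integral_shift_le_pair:
  assumes h: "0 \<le> h"
  shows "(\<integral>p. G (fst p + h) (snd p + h) - G (fst p) (snd p) \<partial>(unit_interval \<Otimes>\<^sub>M unit_interval)) \<le> 2 * h"
proof -
  interpret I: prob_space unit_interval by (rule prob_space_unit_interval)
  interpret P: pair_prob_space unit_interval unit_interval ..
  have [measurable]: "fst \<in> borel_measurable (unit_interval \<Otimes>\<^sub>M unit_interval)"
    "snd \<in> borel_measurable (unit_interval \<Otimes>\<^sub>M unit_interval)"
    by (rule measurable_unit_interval_real; measurable)+
  \<comment> \<open>The diagonal translation moves one coordinate at a time, and each increment is
    integrated first over the coordinate that moves.\<close>
  let ?f = "\<lambda>s t. G (s + h) (t + h) - G s (t + h)" and ?g = "\<lambda>s t. G s (t + h) - G s t"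
  have f: "integrable (unit_interval \<Otimes>\<^sub>M unit_interval) (\<lambda>(s, t). ?f s t)"
    by (rule P.integrable_const_bound[where B = 1]) (auto simp: split_beta' abs_diff_le_1)
  have g: "integrable (unit_interval \<Otimes>\<^sub>M unit_interval) (\<lambda>(s, t). ?g s t)"
    by (rule P.integrable_const_bound[where B = 1]) (auto simp: split_beta' abs_diff_le_1)
  have le: "(\<integral>x. k x \<partial>unit_interval) \<le> h" if "integrable unit_interval k" "\<And>x. k x \<le> h" for k :: "real \<Rightarrow> real"
    using integral_mono[OF that(1), of "\<lambda>_. h"] that(2) I.prob_space by simp
  have "(\<integral>p. G (fst p + h) (snd p + h) - G (fst p) (snd p) \<partial>(unit_interval \<Otimes>\<^sub>M unit_interval))
      = (\<integral>p. (case p of (s, t) \<Rightarrow> ?f s t) + (case p of (s, t) \<Rightarrow> ?g s t) \<partial>(unit_interval \<Otimes>\<^sub>M unit_interval))"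
    by (intro Bochner_Integration.integral_cong) auto
  also have "\<dots> = (\<integral>(s, t). ?f s t \<partial>(unit_interval \<Otimes>\<^sub>M unit_interval))
      + (\<integral>(s, t). ?g s t \<partial>(unit_interval \<Otimes>\<^sub>M unit_interval))"
    by (rule Bochner_Integration.integral_add[OF f g])
  also have "(\<integral>(s, t). ?f s t \<partial>(unit_interval \<Otimes>\<^sub>M unit_interval))
      = (\<integral>t. \<integral>s. ?f s t \<partial>unit_interval \<partial>unit_interval)"
    using P.integral_snd[OF f] by simp
  also have "\<dots> \<le> h"
    by (rule le[OF P.integrable_snd[OF f]], rule integral_shift_le[OF _ _ h]) (use range in auto)
  also have "(\<integral>(s, t). ?g s t \<partial>(unit_interval \<Otimes>\<^sub>M unit_interval))
      = (\<integral>s. \<integral>t. ?g s t \<partial>unit_interval \<partial>unit_interval)"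
    using P.integral_fst[OF g] by simp
  also have "\<dots> \<le> h"
    by (rule le[OF P.integrable_fst[OF g]], rule integral_shift_le[OF _ _ h]) (use range in auto)
  finally show ?thesis by simp
qed

text \<open>Allows \<open>integral_shift_le_pair\<close> to start from a translate, which yields
  two-sided estimates.\<close>

lemma shift: "real_monotone_kernel (\<lambda>s t. G (s + c) (t + c))"
proof
  show "(\<lambda>p. G (fst p + c) (snd p + c)) \<in> borel_measurable borel"
    by (intro measurable_G borel_measurable_add borel_measurable_const)
      (auto simp: borel_prod[symmetric])
qed (use mono range sym in auto)

end

section \<open>Representation over an atomless order\<close>

context atomless_ordered_prob_space
begin

lemma monotone_kernel_representation:
  assumes W: "monotone_kernel M r W"
  obtains G where "real_monotone_kernel G"
    and "AE p in M \<Otimes>\<^sub>M M. W (fst p) (snd p) = G (order_cdf (fst p)) (order_cdf (snd p))"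
proof -
  interpret I: prob_space unit_interval by (rule prob_space_unit_interval)
  interpret P: pair_prob_space M M ..
  interpret PI: pair_prob_space unit_interval unit_interval ..
  let ?F = order_cdf
  have W01: "W x y \<in> {0..1}" and Wsym: "W x y = W y x" if "x \<in> space M" "y \<in> space M" for x y
    using W that by (auto simp: monotone_kernel_def is_kernel_def)
  have Wmono: "W x y \<le> W x' y'"
    if "x \<in> space M" "y \<in> space M" "x' \<in> space M" "y' \<in> space M" "?F x < ?F x'" "?F y < ?F y'" for x y x' y'
    using W that order_cdf_less_imp[of x x'] order_cdf_less_imp[of y y'] unfolding monotone_kernel_def by blast
  have "(\<lambda>(x, y). W x y) \<in> borel_measurable (M \<Otimes>\<^sub>M M)"
    using W by (simp add: monotone_kernel_def is_kernel_def)
  then have [measurable]: "(\<lambda>p. W (fst p) (snd p)) \<in> borel_measurable (M \<Otimes>\<^sub>M M)"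
    by (simp add: split_beta')

  define V where "V s t = {W x y | x y. x \<in> space M \<and> y \<in> space M \<and> ?F x < s \<and> ?F y < t}" for s t
  \<comment> \<open>The inserted 0 supplies a value where \<open>V s t\<close> is empty, for
    instance at \<open>s \<le> 0\<close>. It leaves other suprema unchanged, since \<open>W\<close>
    is nonnegative.\<close>
  define G where "G s t = Sup (insert 0 (V s t))" for s t
  have V01: "v \<in> {0..1}" if "v \<in> V s t" for v s t using that W01 unfolding V_def by blast
  then have bdd: "bdd_above (insert 0 (V s t))" for s t by (intro bdd_aboveI[where M = 1]) auto
  have upper: "v \<le> G s t" if "v \<in> V s t" for v s t
    unfolding G_def using that by (intro cSup_upper bdd) auto
  have G_le: "G s t \<le> c" if "0 \<le> c" "\<And>v. v \<in> V s t \<Longrightarrow> v \<le> c" for s t c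
    unfolding G_def using that by (intro cSup_least) auto
  have Gpos: "0 \<le> G s t" for s t unfolding G_def by (intro cSup_upper bdd) auto
  have G: "real_monotone_kernel G"
  proof
    show "(\<lambda>p. G (fst p) (snd p)) \<in> borel_measurable borel"
      unfolding borel_measurable_iff_greater
    proof
      fix c :: real
      \<comment> \<open>Strictness in \<open>V\<close> makes this set a union of open quadrants. The
        union may be uncountable, but it is open and hence Borel.\<close>
      have "{p. c < G (fst p) (snd p)} = (if c < 0 then UNIV else
          \<Union>(x, y)\<in>{(x, y). x \<in> space M \<and> y \<in> space M \<and> c < W x y}. {?F x<..} \<times> {?F y<..})"
        (is "?L = ?R")
      proof (intro equalityI subsetI)
        fix p assume p: "p \<in> ?L"
        show "p \<in> ?R"
        proof (cases "c < 0")
          case False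
          then have "\<exists>v \<in> V (fst p) (snd p). c < v"
            using p G_le[of c "fst p" "snd p"] by (force simp: not_le)
          then show ?thesis using False by (cases p) (auto simp: V_def)
        qed simp
      next
        fix p assume p: "p \<in> ?R"
        show "p \<in> ?L"
        proof (cases "c < 0")
          case True
          then show ?thesis using Gpos[of "fst p" "snd p"] by simp
        next
          case False
          then obtain x y where "x \<in> space M" "y \<in> space M" "c < W x y" "?F x < fst p" "?F y < snd p"
            using p by auto
          then show ?thesis using upper[of "W x y" "fst p" "snd p"] unfolding V_def by force
        qed
      qed
      also have "open \<dots>" by (auto intro!: open_Times)
      finally show "{p \<in> space borel. c < G (fst p) (snd p)} \<in> sets borel" by simp
    qed
    fix s t s' t' :: real
    show "G s t \<in> {0..1}" using Gpos G_le[of 1 s t] V01 by auto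
    have "V s t = V t s" unfolding V_def using Wsym by blast
    then show "G s t = G t s" by (simp add: G_def)
    assume "s \<le> s'" "t \<le> t'"
    then have "V s t \<subseteq> V s' t'" unfolding V_def by (blast intro: less_le_trans)
    then show "G s t \<le> G s' t'" using upper Gpos by (intro G_le) auto
  qed
  interpret G: real_monotone_kernel G by (rule G)
  \<comment> \<open>Every competitor in \<open>V (?F x) (?F y)\<close> comes from points strictly
    below \<open>x\<close> and \<open>y\<close> in the order, so \<open>Wmono\<close> bounds it by
    \<open>W x y\<close>.\<close>
  have lower: "G (?F x) (?F y) \<le> W x y" if "x \<in> space M" "y \<in> space M" for x y
    using that W01 by (intro G_le) (auto simp: V_def intro: Wmono)
  let ?D = "\<lambda>p. W (fst p) (snd p) - G (?F (fst p)) (?F (snd p))"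
  have D0: "AE p in M \<Otimes>\<^sub>M M. 0 \<le> ?D p" using lower by (auto simp: space_pair_measure)
  have intD: "integrable (M \<Otimes>\<^sub>M M) ?D"
  proof (rule P.integrable_const_bound[where B = 1])
    have "\<bar>W x y - G (?F x) (?F y)\<bar> \<le> 1" if "x \<in> space M" "y \<in> space M" for x y
      using W01[OF that] G.range[of "?F x" "?F y"] by (auto simp: abs_le_iff)
    then show "AE p in M \<Otimes>\<^sub>M M. norm (?D p) \<le> 1" by (auto simp: space_pair_measure)
  qed measurable
  have ub: "(\<integral>p. ?D p \<partial>(M \<Otimes>\<^sub>M M)) \<le> 0 + e" if "e > 0" for e
  proof -
    \<comment> \<open>A diagonal translation by \<open>h\<close> costs at most
      \<open>2 * h\<close>.\<close>
    define h where "h = e / 2"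
    have h: "h > 0" using that by (simp add: h_def)
    let ?S = "\<lambda>p. G (fst p + h) (snd p + h) - G (fst p) (snd p)"
    have mS: "?S \<in> borel_measurable (unit_interval \<Otimes>\<^sub>M unit_interval)"
    proof -
      have [measurable]: "fst \<in> borel_measurable (unit_interval \<Otimes>\<^sub>M unit_interval)"
        "snd \<in> borel_measurable (unit_interval \<Otimes>\<^sub>M unit_interval)"
        by (rule measurable_unit_interval_real; measurable)+
      show ?thesis by measurable
    qed
    have mp: "(\<lambda>(x, y). (?F x, ?F y)) \<in> measure_preserving (M \<Otimes>\<^sub>M M) (unit_interval \<Otimes>\<^sub>M unit_interval)"
      by (rule measure_preserving_pair[OF prob_space_axioms I.prob_space_axioms order_cdf_measure_preserving])
    \<comment> \<open>Where \<open>?F\<close> equals 1 no point has a larger value; these points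
      form a null set.\<close>
    have lt1: "AE x in M. ?F x < 1"
      by (rule AE_measure_preserving[OF order_cdf_measure_preserving AE_unit_interval_less_1])
    have "AE p in M \<Otimes>\<^sub>M M. ?F (fst p) < 1 \<and> ?F (snd p) < 1"
      using lt1 by (intro P.AE_pair_measure) auto
    then have "AE p in M \<Otimes>\<^sub>M M. ?D p \<le> ?S (case p of (x, y) \<Rightarrow> (?F x, ?F y))"
    proof (rule AE_mp, intro AE_I2 impI)
      fix p assume p: "p \<in> space (M \<Otimes>\<^sub>M M)" "?F (fst p) < 1 \<and> ?F (snd p) < 1"
      then obtain x y where xy: "p = (x, y)" "x \<in> space M" "y \<in> space M" "?F x < 1" "?F y < 1"
        by (auto simp: space_pair_measure)
      \<comment> \<open>Such an \<open>x'\<close> is above \<open>x\<close> in the order, so that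
        \<open>W\<close> can only grow, and yet \<open>W x' y'\<close> still competes in the
        supremum defining \<open>G\<close> at the shifted point.\<close>
      obtain x' where x': "x' \<in> space M" "?F x < ?F x'" "?F x' < ?F x + h"
        using order_cdf_dense[of "?F x" "?F x + h"] xy h order_cdf_bounds[of x] by auto
      obtain y' where y': "y' \<in> space M" "?F y < ?F y'" "?F y' < ?F y + h"
        using order_cdf_dense[of "?F y" "?F y + h"] xy h order_cdf_bounds[of y] by auto
      have "W x y \<le> W x' y'" by (rule Wmono) (use xy x' y' in auto)
      also have "\<dots> \<le> G (?F x + h) (?F y + h)" using x' y' by (intro upper) (auto simp: V_def)
      finally show "?D p \<le> ?S (case p of (x, y) \<Rightarrow> (?F x, ?F y))" using xy by simp
    qed
    then have "(\<integral>p. ?D p \<partial>(M \<Otimes>\<^sub>M M)) \<le> (\<integral>p. ?S (case p of (x, y) \<Rightarrow> (?F x, ?F y)) \<partial>(M \<Otimes>\<^sub>M M))"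
    proof (intro integral_mono_AE[OF intD])
      show "integrable (M \<Otimes>\<^sub>M M) (\<lambda>p. ?S (case p of (x, y) \<Rightarrow> (?F x, ?F y)))"
        by (rule P.integrable_const_bound[where B = 1])
          (auto simp: split_beta' G.abs_diff_le_1)
    qed
    also have "\<dots> = (\<integral>p. ?S p \<partial>(unit_interval \<Otimes>\<^sub>M unit_interval))"
      by (rule integral_measure_preserving[OF mp mS])
    also have "\<dots> \<le> 2 * h" using h by (intro G.integral_shift_le_pair) simp
    finally show ?thesis by (simp add: h_def)
  qed
  have "(\<integral>p. ?D p \<partial>(M \<Otimes>\<^sub>M M)) = 0"
    using field_le_epsilon[OF ub] integral_nonneg_AE[OF D0] by linarith
  then have "AE p in M \<Otimes>\<^sub>M M. ?D p = 0"
    using integral_nonneg_eq_0_iff_AE[OF intD D0] by blast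
  then show thesis by (intro that[OF G]) auto
qed

end

context ordered_prob_space
begin

text \<open>\<open>F\<close> lives on the enlarged space because an atom of \<open>M\<close> must be
  spread over an interval. \<open>W\<close> ignores the uniform coordinate and so stays monotone for
  the lexicographic order.\<close>

lemma monotone_kernel_representation:
  assumes W: "monotone_kernel M r W"
  obtains F G where "F \<in> measure_preserving (M \<Otimes>\<^sub>M unit_interval) unit_interval"
    and "real_monotone_kernel G"
    and "AE p in (M \<Otimes>\<^sub>M unit_interval) \<Otimes>\<^sub>M (M \<Otimes>\<^sub>M unit_interval).
      W (fst (fst p)) (fst (snd p)) = G (F (fst p)) (F (snd p))"
proof -
  interpret L: atomless_ordered_prob_space "M \<Otimes>\<^sub>M unit_interval" lex_order by (rule atomless_lex_order)
  have [measurable]: "(\<lambda>(x, y). W x y) \<in> borel_measurable (M \<Otimes>\<^sub>M M)"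
    using W by (simp add: monotone_kernel_def is_kernel_def)
  have "(\<lambda>p. case (fst (fst p), fst (snd p)) of (x, y) \<Rightarrow> W x y)
      \<in> borel_measurable ((M \<Otimes>\<^sub>M unit_interval) \<Otimes>\<^sub>M (M \<Otimes>\<^sub>M unit_interval))"
    by measurable
  then have "monotone_kernel (M \<Otimes>\<^sub>M unit_interval) lex_order (\<lambda>p q. W (fst p) (fst q))"
    using W unfolding monotone_kernel_def is_kernel_def
    by (auto simp: lex_order_iff space_pair_measure split_beta')
  then obtain G where "real_monotone_kernel G"
    "AE p in (M \<Otimes>\<^sub>M unit_interval) \<Otimes>\<^sub>M (M \<Otimes>\<^sub>M unit_interval).
      W (fst (fst p)) (fst (snd p)) = G (L.order_cdf (fst p)) (L.order_cdf (snd p))"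
    by (rule L.monotone_kernel_representation)
  then show thesis by (rule that[OF L.order_cdf_measure_preserving])
qed

end

section \<open>Cut norms and couplings\<close>

lemma cut_norm_le:
  assumes "\<And>f g. f \<in> borel_measurable M \<Longrightarrow> f \<in> space M \<rightarrow> {-1..1} \<Longrightarrow>
    g \<in> borel_measurable M \<Longrightarrow> g \<in> space M \<rightarrow> {-1..1} \<Longrightarrow>
    \<bar>\<integral>(x, y). W x y * f x * g y \<partial>(M \<Otimes>\<^sub>M M)\<bar> \<le> c"
  shows "cut_norm M W \<le> c"
  unfolding cut_norm_def
proof (rule cSup_least)
  show "{\<bar>\<integral>(x, y). W x y * f x * g y \<partial>(M \<Otimes>\<^sub>M M)\<bar> | f g.
       f \<in> borel_measurable M \<and> f \<in> space M \<rightarrow> {-1..1} \<and>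
       g \<in> borel_measurable M \<and> g \<in> space M \<rightarrow> {-1..1}} \<noteq> {}"
    by (auto intro!: exI[of _ "\<lambda>_. 0"])
qed (use assms in blast)

lemma le_cut_norm:
  assumes "prob_space M" "(\<lambda>(x, y). W x y) \<in> borel_measurable (M \<Otimes>\<^sub>M M)"
    and "\<And>x y. x \<in> space M \<Longrightarrow> y \<in> space M \<Longrightarrow> \<bar>W x y\<bar> \<le> B"
    and "f \<in> borel_measurable M" "f \<in> space M \<rightarrow> {-1..1}"
      "g \<in> borel_measurable M" "g \<in> space M \<rightarrow> {-1..1}"
  shows "\<bar>\<integral>(x, y). W x y * f x * g y \<partial>(M \<Otimes>\<^sub>M M)\<bar> \<le> cut_norm M W"
  unfolding cut_norm_def
  by (rule cSup_upper[OF _ cut_norm_bdd_above[OF assms(1-3)]]) (use assms(4-7) in blast)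

lemma integrable_cut_integrand:
  fixes W :: "'a \<Rightarrow> 'a \<Rightarrow> real"
  assumes "prob_space M" and [measurable]: "(\<lambda>(x, y). W x y) \<in> borel_measurable (M \<Otimes>\<^sub>M M)"
    and W: "\<And>x y. x \<in> space M \<Longrightarrow> y \<in> space M \<Longrightarrow> \<bar>W x y\<bar> \<le> B"
    and [measurable]: "f \<in> borel_measurable M" "g \<in> borel_measurable M"
    and fg: "f \<in> space M \<rightarrow> {-1..1}" "g \<in> space M \<rightarrow> {-1..1}"
  shows "integrable (M \<Otimes>\<^sub>M M) (\<lambda>(x, y). W x y * f x * g y)"
proof -
  interpret prob_space M by fact
  interpret P: pair_prob_space M M ..
  have [measurable]: "(\<lambda>p. W (fst p) (snd p)) \<in> borel_measurable (M \<Otimes>\<^sub>M M)"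
    using assms(2) by (simp add: split_beta')
  show ?thesis
  proof (rule P.integrable_const_bound[where B = B])
    have "\<bar>W x y * f x * g y\<bar> \<le> B" if "x \<in> space M" "y \<in> space M" for x y
    proof -
      have "\<bar>f x\<bar> \<le> 1" "\<bar>g y\<bar> \<le> 1" using fg that by (auto simp: Pi_iff abs_le_iff)
      then have "\<bar>W x y\<bar> * \<bar>f x\<bar> * \<bar>g y\<bar> \<le> \<bar>W x y\<bar> * 1 * 1" by (intro mult_mono) auto
      then show ?thesis using W[OF that] by (simp add: abs_mult)
    qed
    then show "AE p in M \<Otimes>\<^sub>M M. norm (case p of (x, y) \<Rightarrow> W x y * f x * g y) \<le> B"
      by (auto simp: space_pair_measure)
    show "(\<lambda>(x, y). W x y * f x * g y) \<in> borel_measurable (M \<Otimes>\<^sub>M M)"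
      unfolding split_beta' by measurable
  qed
qed

text \<open>Test functions are bounded by 1, so cut norms differ by at most the \<open>L1\<close>
  distance. An arbitrary integrable majorant \<open>D\<close> makes it possible to insert an
  integral already estimated: that of 0, or of an increment of \<open>G\<close> under
  translation.\<close>

lemma cut_norm_perturb:
  fixes U V :: "'a \<Rightarrow> 'a \<Rightarrow> real"
  assumes M: "prob_space M"
    and U: "(\<lambda>(x, y). U x y) \<in> borel_measurable (M \<Otimes>\<^sub>M M)"
      "\<And>x y. x \<in> space M \<Longrightarrow> y \<in> space M \<Longrightarrow> \<bar>U x y\<bar> \<le> B"
    and V: "(\<lambda>(x, y). V x y) \<in> borel_measurable (M \<Otimes>\<^sub>M M)"
      "\<And>x y. x \<in> space M \<Longrightarrow> y \<in> space M \<Longrightarrow> \<bar>V x y\<bar> \<le> B"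
    and D: "integrable (M \<Otimes>\<^sub>M M) D"
      "AE p in M \<Otimes>\<^sub>M M. \<bar>U (fst p) (snd p) - V (fst p) (snd p)\<bar> \<le> D p"
  shows "cut_norm M U \<le> cut_norm M V + (\<integral>p. D p \<partial>(M \<Otimes>\<^sub>M M))"
proof (rule cut_norm_le)
  fix f g :: "'a \<Rightarrow> real"
  assume f: "f \<in> borel_measurable M" "f \<in> space M \<rightarrow> {-1..1}"
    and g: "g \<in> borel_measurable M" "g \<in> space M \<rightarrow> {-1..1}"
  let ?u = "\<lambda>p. case p of (x, y) \<Rightarrow> U x y * f x * g y"
  let ?v = "\<lambda>p. case p of (x, y) \<Rightarrow> V x y * f x * g y"
  have iu: "integrable (M \<Otimes>\<^sub>M M) ?u" and iv: "integrable (M \<Otimes>\<^sub>M M) ?v"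
    using integrable_cut_integrand[OF M U f(1) g(1) f(2) g(2)]
      integrable_cut_integrand[OF M V f(1) g(1) f(2) g(2)] by auto
  have "\<bar>integral\<^sup>L (M \<Otimes>\<^sub>M M) ?u - integral\<^sup>L (M \<Otimes>\<^sub>M M) ?v\<bar> = \<bar>\<integral>p. ?u p - ?v p \<partial>(M \<Otimes>\<^sub>M M)\<bar>"
    by (simp only: Bochner_Integration.integral_diff[OF iu iv])
  also have "\<dots> \<le> (\<integral>p. \<bar>?u p - ?v p\<bar> \<partial>(M \<Otimes>\<^sub>M M))" by (rule integral_abs_bound)
  also have "\<dots> \<le> (\<integral>p. D p \<partial>(M \<Otimes>\<^sub>M M))"
  proof (rule integral_mono_AE)
    show "AE p in M \<Otimes>\<^sub>M M. \<bar>?u p - ?v p\<bar> \<le> D p"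
      using D(2)
    proof (rule AE_mp, intro AE_I2 impI)
      fix p assume p: "p \<in> space (M \<Otimes>\<^sub>M M)" "\<bar>U (fst p) (snd p) - V (fst p) (snd p)\<bar> \<le> D p"
      obtain x y where xy: "p = (x, y)" "x \<in> space M" "y \<in> space M"
        using p(1) by (auto simp: space_pair_measure)
      have "\<bar>f x\<bar> \<le> 1" "\<bar>g y\<bar> \<le> 1" using f g xy by (auto simp: Pi_iff abs_le_iff)
      then have "\<bar>U x y - V x y\<bar> * \<bar>f x\<bar> * \<bar>g y\<bar> \<le> \<bar>U x y - V x y\<bar> * 1 * 1"
        by (intro mult_mono) auto
      then have "\<bar>(U x y - V x y) * f x * g y\<bar> \<le> \<bar>U x y - V x y\<bar>" by (simp add: abs_mult)
      then show "\<bar>?u p - ?v p\<bar> \<le> D p" using p(2) xy(1) by (simp add: left_diff_distrib)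
    qed
    show "integrable (M \<Otimes>\<^sub>M M) (\<lambda>p. \<bar>?u p - ?v p\<bar>)"
      by (intro integrable_abs Bochner_Integration.integrable_diff iu iv)
  qed (rule D(1))
  finally show "\<bar>integral\<^sup>L (M \<Otimes>\<^sub>M M) ?u\<bar> \<le> cut_norm M V + (\<integral>p. D p \<partial>(M \<Otimes>\<^sub>M M))"
    using le_cut_norm[OF M V f g] by linarith
qed

text \<open>The product of \<open>M\<close> and \<open>N\<close> is a coupling, so
  \<open>Inf\<close> in \<open>delta_cut\<close> is taken over a nonempty set and near-optimal
  couplings exist.\<close>

lemma
  assumes "prob_space M" "prob_space N" and K: "is_kernel M W" "is_kernel N V"
  shows delta_cut_nonneg: "0 \<le> delta_cut M W N V"
    and delta_cut_lessD: "delta_cut M W N V < e \<Longrightarrow> \<exists>(S :: ('a \<times> 'b) measure) \<phi> \<psi>. prob_space S \<and>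
      \<phi> \<in> measure_preserving S (M :: 'a measure) \<and> \<psi> \<in> measure_preserving S (N :: 'b measure) \<and>
      cut_norm S (\<lambda>x y. pullback W \<phi> x y - pullback V \<psi> x y) < e"
proof -
  interpret M: prob_space M by fact
  interpret N: prob_space N by fact
  interpret P: pair_prob_space M N ..
  let ?C = "{cut_norm S (\<lambda>x y. pullback W \<phi>\<^sub>1 x y - pullback V \<phi>\<^sub>2 x y)
       | (S :: ('a \<times> 'b) measure) \<phi>\<^sub>1 \<phi>\<^sub>2.
       prob_space S \<and> \<phi>\<^sub>1 \<in> measure_preserving S M \<and> \<phi>\<^sub>2 \<in> measure_preserving S N}"
  have "distr (M \<Otimes>\<^sub>M N) M fst = M" by (rule N.distr_pair_fst)
  moreover have "distr (M \<Otimes>\<^sub>M N) N snd = N"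
  proof (rule measure_eqI)
    fix A assume "A \<in> sets (distr (M \<Otimes>\<^sub>M N) N snd)"
    then have [measurable]: "A \<in> sets N" by simp
    have "snd -` A \<inter> space (M \<Otimes>\<^sub>M N) = space M \<times> A"
      using sets.sets_into_space[of A N] by (auto simp: space_pair_measure)
    then show "emeasure (distr (M \<Otimes>\<^sub>M N) N snd) A = emeasure N A"
      by (simp add: emeasure_distr N.emeasure_pair_measure_Times M.emeasure_space_1)
  qed simp
  ultimately have ne: "?C \<noteq> {}"
    using P.prob_space_axioms by (auto simp: measure_preserving_def intro!: exI[of _ "M \<Otimes>\<^sub>M N"] exI[of _ fst] exI[of _ snd])
  have nn: "0 \<le> c" if "c \<in> ?C" for c
    using that by (auto simp: measure_preserving_def intro!: cut_norm_nonneg pullback_diff[OF K])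
  show "0 \<le> delta_cut M W N V"
    unfolding delta_cut_def using ne nn by (rule cInf_greatest)
  assume "delta_cut M W N V < e"
  then show "\<exists>(S :: ('a \<times> 'b) measure) \<phi> \<psi>. prob_space S \<and>
      \<phi> \<in> measure_preserving S M \<and> \<psi> \<in> measure_preserving S N \<and>
      cut_norm S (\<lambda>x y. pullback W \<phi> x y - pullback V \<psi> x y) < e"
    unfolding delta_cut_def using cInf_lessD[OF ne, of e] by blast
qed

lemma equivalent_kernelsI:
  assumes "prob_space M" "prob_space N" "is_kernel M W" "is_kernel N V"
    and "\<And>e. e > 0 \<Longrightarrow> delta_cut M W N V \<le> e"
  shows "equivalent_kernels M W N V"
  using delta_cut_nonneg[OF assms(1-4)] field_le_epsilon[of "delta_cut M W N V" 0] assms(5)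
  by (simp add: equivalent_kernels_def)

section \<open>Couplings given by densities on a product\<close>

text \<open>Integrating a test function along \<open>Q\<close> against the density \<open>k\<close> gives a test function on \<open>T\<close>,
  so passing from \<open>T\<close> to the larger space does not increase cut norms.\<close>

locale coupling_density = T: prob_space T + Q: prob_space Q
  for T :: "'t measure" and Q :: "'q measure" +
  fixes k :: "'t \<times> 'q \<Rightarrow> real"
  assumes measurable_k [measurable]: "k \<in> borel_measurable (T \<Otimes>\<^sub>M Q)"
    and k_nonneg: "0 \<le> k p"
    and mass_le: "t \<in> space T \<Longrightarrow> (\<integral>\<^sup>+q. k (t, q) \<partial>Q) \<le> 1"
    and mass_T: "AE t in T. (\<integral>\<^sup>+q. k (t, q) \<partial>Q) = 1"
    and mass_Q: "AE q in Q. (\<integral>\<^sup>+t. k (t, q) \<partial>T) = 1"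
begin

sublocale TQ: pair_prob_space T Q ..

text \<open>Given the first coordinate, the second has conditional density \<open>k (t, _)\<close>
  with respect to \<open>Q\<close>. This explicit conditional law takes the place of a
  disintegration.\<close>

definition coupling :: "('t \<times> 'q) measure" where
  "coupling = density (T \<Otimes>\<^sub>M Q) k"

lemma sets_coupling [measurable_cong, simp]: "sets coupling = sets (T \<Otimes>\<^sub>M Q)"
  by (simp add: coupling_def)

lemma space_coupling [simp]: "space coupling = space (T \<Otimes>\<^sub>M Q)"
  by (simp add: coupling_def)

lemma fst_measure_preserving: "fst \<in> measure_preserving coupling T"
proof -
  have "distr coupling T fst = T"
  proof (rule measure_eqI)
    fix A assume "A \<in> sets (distr coupling T fst)"
    then have [measurable]: "A \<in> sets T" by simp
    have "emeasure (distr coupling T fst) A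
        = (\<integral>\<^sup>+p. ennreal (k p) * indicator (fst -` A \<inter> space coupling) p \<partial>(T \<Otimes>\<^sub>M Q))"
      by (subst emeasure_distr) (auto simp: coupling_def emeasure_density)
    also have "\<dots> = (\<integral>\<^sup>+p. ennreal (k p) * indicator A (fst p) \<partial>(T \<Otimes>\<^sub>M Q))"
      by (rule nn_integral_cong) (auto simp: indicator_def)
    also have "\<dots> = (\<integral>\<^sup>+t. \<integral>\<^sup>+q. ennreal (k (t, q)) * indicator A t \<partial>Q \<partial>T)"
      by (subst Q.nn_integral_fst[symmetric]) auto
    also have "\<dots> = (\<integral>\<^sup>+t. (\<integral>\<^sup>+q. k (t, q) \<partial>Q) * indicator A t \<partial>T)"
      by (intro nn_integral_cong nn_integral_multc) measurable
    also have "\<dots> = (\<integral>\<^sup>+t. indicator A t \<partial>T)"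
      by (rule nn_integral_cong_AE) (use mass_T in auto)
    finally show "emeasure (distr coupling T fst) A = emeasure T A" by simp
  qed simp
  then show ?thesis by (simp add: measure_preserving_def)
qed

lemma snd_measure_preserving: "snd \<in> measure_preserving coupling Q"
proof -
  have "distr coupling Q snd = Q"
  proof (rule measure_eqI)
    fix A assume "A \<in> sets (distr coupling Q snd)"
    then have [measurable]: "A \<in> sets Q" by simp
    have "emeasure (distr coupling Q snd) A
        = (\<integral>\<^sup>+p. ennreal (k p) * indicator (snd -` A \<inter> space coupling) p \<partial>(T \<Otimes>\<^sub>M Q))"
      by (subst emeasure_distr) (auto simp: coupling_def emeasure_density)
    also have "\<dots> = (\<integral>\<^sup>+p. ennreal (k p) * indicator A (snd p) \<partial>(T \<Otimes>\<^sub>M Q))"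
      by (rule nn_integral_cong) (auto simp: indicator_def)
    also have "\<dots> = (\<integral>\<^sup>+q. \<integral>\<^sup>+t. ennreal (k (t, q)) * indicator A q \<partial>T \<partial>Q)"
      by (subst TQ.nn_integral_snd[symmetric]) auto
    also have "\<dots> = (\<integral>\<^sup>+q. (\<integral>\<^sup>+t. k (t, q) \<partial>T) * indicator A q \<partial>Q)"
      by (intro nn_integral_cong nn_integral_multc) measurable
    also have "\<dots> = (\<integral>\<^sup>+q. indicator A q \<partial>Q)"
      by (rule nn_integral_cong_AE) (use mass_Q in auto)
    finally show "emeasure (distr coupling Q snd) A = emeasure Q A" by simp
  qed simp
  then show ?thesis by (simp add: measure_preserving_def)
qed

lemma prob_space_coupling: "prob_space coupling"
proof (rule prob_spaceI)
  have "emeasure T (space T) = emeasure (distr coupling T fst) (space T)"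
    using fst_measure_preserving by (simp add: measure_preserving_def)
  also have "\<dots> = emeasure coupling (space coupling)"
    by (subst emeasure_distr) (auto intro!: arg_cong2[where f = emeasure] simp: space_pair_measure)
  finally show "emeasure coupling (space coupling) = 1" by (simp add: T.emeasure_space_1)
qed

text \<open>A version of the conditional expectation of \<open>f\<close> given the first
  coordinate.\<close>

definition fibre_avg :: "('t \<times> 'q \<Rightarrow> real) \<Rightarrow> 't \<Rightarrow> real" where
  "fibre_avg f t = (\<integral>q. k (t, q) * f (t, q) \<partial>Q)"

lemma measurable_fibre_avg [measurable]:
  assumes [measurable]: "f \<in> borel_measurable coupling"
  shows "fibre_avg f \<in> borel_measurable T"
  unfolding fibre_avg_def by measurable

text \<open>A test function on \<open>T\<close> must be bounded by 1 at every point. This is why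
  \<open>mass_le\<close> holds everywhere, while total mass exactly 1 is asked only almost
  everywhere.\<close>

lemma fibre_avg_bounds:
  assumes [measurable]: "f \<in> borel_measurable coupling" and f: "f \<in> space coupling \<rightarrow> {-1..1}"
  shows "fibre_avg f \<in> space T \<rightarrow> {-1..1}"
proof
  fix t assume t [measurable]: "t \<in> space T"
  have int: "integrable Q (\<lambda>q. k (t, q))"
    by (rule integrableI_nonneg) (use mass_le[OF t] k_nonneg in \<open>auto intro: le_less_trans\<close>)
  have "\<bar>fibre_avg f t\<bar> \<le> (\<integral>q. \<bar>k (t, q) * f (t, q)\<bar> \<partial>Q)"
    unfolding fibre_avg_def by (rule integral_abs_bound)
  also have "\<dots> \<le> (\<integral>q. k (t, q) \<partial>Q)"
  proof (rule integral_mono'[OF int])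
    fix q assume "q \<in> space Q"
    then have "f (t, q) \<in> {-1..1}" using f t by (auto simp: space_pair_measure Pi_iff)
    then have "\<bar>f (t, q)\<bar> \<le> 1" by auto
    then show "\<bar>k (t, q) * f (t, q)\<bar> \<le> k (t, q)"
      using k_nonneg[of "(t, q)"] by (simp add: abs_mult mult_left_le)
  qed (use k_nonneg in auto)
  also have "\<dots> \<le> 1"
    using mass_le[OF t] nn_integral_eq_integral[OF int] k_nonneg by simp
  finally show "fibre_avg f t \<in> {-1..1}" by (auto simp: abs_le_iff)
qed

lemma integral_fibre_avg:
  assumes [measurable]: "h \<in> borel_measurable T" "f \<in> borel_measurable coupling"
    and h: "\<And>t. t \<in> space T \<Longrightarrow> \<bar>h t\<bar> \<le> B"
    and f: "f \<in> space coupling \<rightarrow> {-1..1}"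
  shows "(\<integral>p. h (fst p) * f p \<partial>coupling) = (\<integral>t. h t * fibre_avg f t \<partial>T)"
proof -
  interpret S: prob_space coupling by (rule prob_space_coupling)
  have [measurable]: "f \<in> borel_measurable (T \<Otimes>\<^sub>M Q)" using assms(2) by (simp add: coupling_def)
  have "integrable coupling (\<lambda>p. h (fst p) * f p)"
  proof (rule S.integrable_const_bound[where B = B])
    have "\<bar>h (fst p) * f p\<bar> \<le> B" if "p \<in> space coupling" for p
    proof -
      have "\<bar>f p\<bar> \<le> 1" using f that by (auto simp: Pi_iff abs_le_iff)
      then have "\<bar>h (fst p)\<bar> * \<bar>f p\<bar> \<le> \<bar>h (fst p)\<bar> * 1" by (intro mult_mono) auto
      then show ?thesis using h[of "fst p"] that by (auto simp: abs_mult space_pair_measure)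
    qed
    then show "AE p in coupling. norm (h (fst p) * f p) \<le> B" by (intro AE_I2) simp
  qed measurable
  then have int: "integrable (T \<Otimes>\<^sub>M Q) (\<lambda>(t, q). k (t, q) * (h t * f (t, q)))"
    unfolding coupling_def by (subst (asm) integrable_density) (auto simp: k_nonneg split_beta')
  have "(\<integral>p. h (fst p) * f p \<partial>coupling) = (\<integral>(t, q). k (t, q) * (h t * f (t, q)) \<partial>(T \<Otimes>\<^sub>M Q))"
    unfolding coupling_def by (subst integral_density) (auto simp: k_nonneg split_beta')
  also have "\<dots> = (\<integral>t. \<integral>q. k (t, q) * (h t * f (t, q)) \<partial>Q \<partial>T)"
    using TQ.integral_fst[OF int] by simp
  also have "\<dots> = (\<integral>t. h t * fibre_avg f t \<partial>T)"
    by (simp add: fibre_avg_def mult.left_commute)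
  finally show ?thesis .
qed

lemma cut_norm_coupling_le:
  assumes U [measurable]: "(\<lambda>(x, y). U x y) \<in> borel_measurable (T \<Otimes>\<^sub>M T)"
    and B: "\<And>x y. x \<in> space T \<Longrightarrow> y \<in> space T \<Longrightarrow> \<bar>U x y\<bar> \<le> B"
  shows "cut_norm coupling (\<lambda>p q. U (fst p) (fst q)) \<le> cut_norm T U"
proof (rule cut_norm_le)
  fix f g :: "'t \<times> 'q \<Rightarrow> real"
  assume fm [measurable]: "f \<in> borel_measurable coupling" and f: "f \<in> space coupling \<rightarrow> {-1..1}"
    and gm [measurable]: "g \<in> borel_measurable coupling" and g: "g \<in> space coupling \<rightarrow> {-1..1}"
  interpret S: prob_space coupling by (rule prob_space_coupling)
  interpret SS: pair_prob_space coupling coupling ..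
  interpret TT: pair_prob_space T T ..
  have Um [measurable]: "(\<lambda>p. U (fst p) (snd p)) \<in> borel_measurable (T \<Otimes>\<^sub>M T)"
    using U by (simp add: split_beta')
  have "(\<lambda>p. case (fst (fst p), fst (snd p)) of (x, y) \<Rightarrow> U x y) \<in> borel_measurable (coupling \<Otimes>\<^sub>M coupling)"
    by measurable
  then have US: "(\<lambda>(p, q). U (fst p) (fst q)) \<in> borel_measurable (coupling \<Otimes>\<^sub>M coupling)"
    by (simp add: split_beta')
  have BS: "\<bar>U (fst p) (fst q)\<bar> \<le> B" if "p \<in> space coupling" "q \<in> space coupling" for p q
    using that B by (auto simp: space_pair_measure)
  note f' = measurable_fibre_avg[OF fm] fibre_avg_bounds[OF fm f]
  note g' = measurable_fibre_avg[OF gm] fibre_avg_bounds[OF gm g]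
  have Usec [measurable]: "U t \<in> borel_measurable T" if [measurable]: "t \<in> space T" for t
  proof -
    have "(\<lambda>s. case (t, s) of (x, y) \<Rightarrow> U x y) \<in> borel_measurable T" by measurable
    then show ?thesis by simp
  qed
  \<comment> \<open>Replacing \<open>g\<close> by its fibre average first leaves a bounded function
    of the first coordinate alone, so the averaging identity applies a second time, to
    \<open>f\<close>.\<close>
  define h where "h t = (\<integral>s. U t s * fibre_avg g s \<partial>T)" for t
  have hm [measurable]: "h \<in> borel_measurable T"
  proof -
    have "(\<lambda>t. \<integral>s. (case (t, s) of (x, y) \<Rightarrow> U x y) * fibre_avg g s \<partial>T) \<in> borel_measurable T"
      by measurable
    then show ?thesis by (simp add: h_def[abs_def])
  qed
  have hB: "\<bar>h t\<bar> \<le> B" if t: "t \<in> space T" for t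
  proof -
    have "\<bar>h t\<bar> \<le> (\<integral>s. \<bar>U t s * fibre_avg g s\<bar> \<partial>T)" unfolding h_def by (rule integral_abs_bound)
    also have "\<dots> \<le> (\<integral>s. B \<partial>T)"
    proof (rule integral_mono')
      fix s assume s: "s \<in> space T"
      have "\<bar>fibre_avg g s\<bar> \<le> 1" using g'(2) s by (auto simp: Pi_iff abs_le_iff)
      then have "\<bar>U t s\<bar> * \<bar>fibre_avg g s\<bar> \<le> \<bar>U t s\<bar> * 1" by (intro mult_mono) auto
      then show "\<bar>U t s * fibre_avg g s\<bar> \<le> B" using B[OF t s] by (simp add: abs_mult)
    next
      fix s assume s: "s \<in> space T"
      show "0 \<le> B" using B[OF t s] by linarith
    qed simp
    finally show ?thesis by (simp add: T.prob_space)
  qed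
  have "(\<integral>(p, q). U (fst p) (fst q) * f p * g q \<partial>(coupling \<Otimes>\<^sub>M coupling))
      = (\<integral>p. \<integral>q. U (fst p) (fst q) * f p * g q \<partial>coupling \<partial>coupling)"
    using SS.integral_fst[OF integrable_cut_integrand[OF prob_space_coupling US BS fm gm f g]] by simp
  also have "\<dots> = (\<integral>p. h (fst p) * f p \<partial>coupling)"
  proof (rule Bochner_Integration.integral_cong)
    fix p assume "p \<in> space coupling"
    then have p: "fst p \<in> space T" by (auto simp: space_pair_measure)
    have "(\<integral>q. U (fst p) (fst q) * f p * g q \<partial>coupling) = (\<integral>q. f p * (U (fst p) (fst q) * g q) \<partial>coupling)"
      by (simp add: mult_ac)
    also have "\<dots> = f p * (\<integral>q. U (fst p) (fst q) * g q \<partial>coupling)" by simp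
    also have "(\<integral>q. U (fst p) (fst q) * g q \<partial>coupling) = h (fst p)"
      unfolding h_def by (rule integral_fibre_avg[OF Usec[OF p] gm B[OF p] g])
    finally show "(\<integral>q. U (fst p) (fst q) * f p * g q \<partial>coupling) = h (fst p) * f p" by simp
  qed simp
  also have "\<dots> = (\<integral>t. h t * fibre_avg f t \<partial>T)" by (rule integral_fibre_avg[OF hm fm hB f])
  also have "\<dots> = (\<integral>t. \<integral>s. U t s * fibre_avg f t * fibre_avg g s \<partial>T \<partial>T)"
    unfolding h_def by (simp add: mult_ac flip: integral_mult_right_zero)
  also have "\<dots> = (\<integral>(t, s). U t s * fibre_avg f t * fibre_avg g s \<partial>(T \<Otimes>\<^sub>M T))"
    using TT.integral_fst[OF integrable_cut_integrand[OF T.prob_space_axioms U B f'(1) g'(1) f'(2) g'(2)]] by simp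
  finally show "\<bar>\<integral>(p, q). U (fst p) (fst q) * f p * g q \<partial>(coupling \<Otimes>\<^sub>M coupling)\<bar> \<le> cut_norm T U"
    using le_cut_norm[OF T.prob_space_axioms U B f' g'] by simp
qed

end

text \<open>The joint density of two uniform variables that share a cell of length
  \<open>1 / n\<close> and are independent within it; the height \<open>n\<close> normalises a
  cell.\<close>

definition grid_density :: "nat \<Rightarrow> real \<Rightarrow> real \<Rightarrow> real" where
  "grid_density n s t = (if \<lfloor>n * s\<rfloor> = \<lfloor>n * t\<rfloor> then n else 0)"

lemma grid_density_nonneg: "0 \<le> grid_density n s t"
  by (simp add: grid_density_def)

lemma grid_density_commute: "grid_density n s t = grid_density n t s"
  by (simp add: grid_density_def)

lemma measurable_grid_density [measurable (raw)]:
  assumes [measurable]: "f \<in> borel_measurable M" "g \<in> borel_measurable M"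
  shows "(\<lambda>x. grid_density n (f x) (g x)) \<in> borel_measurable M"
  unfolding grid_density_def by measurable

lemma grid_density_pos_imp:
  assumes "0 < n" "0 < grid_density n s t" shows "\<bar>s - t\<bar> \<le> 1 / n"
proof -
  have "\<lfloor>n * s\<rfloor> = \<lfloor>n * t\<rfloor>" using assms by (auto simp: grid_density_def split: if_splits)
  then have "\<bar>n * s - n * t\<bar> \<le> 1" by linarith
  then have "n * \<bar>s - t\<bar> \<le> 1" by (simp add: abs_mult flip: right_diff_distrib)
  then show ?thesis using assms(1) by (simp add: field_simps)
qed

text \<open>For \<open>0 \<le> s < 1\<close> the half-open cell of \<open>s\<close> lies in
  \<open>{0..1}\<close> and has length \<open>1 / n\<close>. At \<open>s = 1\<close> it meets the
  interval in a single point, so in general only the inequality holds.\<close>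

lemma nn_integral_grid_density:
  assumes n: "0 < n"
  shows "(\<integral>\<^sup>+t. grid_density n s t \<partial>unit_interval) \<le> 1"
    and "0 \<le> s \<Longrightarrow> s < 1 \<Longrightarrow> (\<integral>\<^sup>+t. grid_density n s t \<partial>unit_interval) = 1"
proof -
  let ?j = "real_of_int \<lfloor>n * s\<rfloor>"
  let ?A = "{?j / n..<(?j + 1) / n}"
  have A: "t \<in> ?A \<longleftrightarrow> \<lfloor>n * s\<rfloor> = \<lfloor>n * t\<rfloor>" for t :: real
  proof -
    have "t \<in> ?A \<longleftrightarrow> ?j \<le> n * t \<and> n * t < ?j + 1" using n by (auto simp: field_simps)
    then show ?thesis by linarith
  qed
  have eq: "(\<integral>\<^sup>+t. grid_density n s t \<partial>unit_interval) = of_nat n * emeasure lborel (?A \<inter> {0..1})"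
  proof -
    have "(\<integral>\<^sup>+t. grid_density n s t \<partial>unit_interval)
        = (\<integral>\<^sup>+t. ennreal (grid_density n s t) * indicator {0..1} t \<partial>lborel)"
      unfolding unit_interval_def by (rule nn_integral_restrict_space) simp
    also have "\<dots> = (\<integral>\<^sup>+t. of_nat n * indicator (?A \<inter> {0..1}) t \<partial>lborel)"
    proof (rule nn_integral_cong)
      fix t :: real
      have "ennreal (grid_density n s t) = of_nat n * indicator ?A t"
        using A[of t] by (cases "t \<in> ?A")
          (simp_all add: grid_density_def ennreal_of_nat_eq_real_of_nat del: atLeastLessThan_iff)
      then show "ennreal (grid_density n s t) * indicator {0..1} t = of_nat n * indicator (?A \<inter> {0..1}) t"
        by (simp add: indicator_inter_arith mult.assoc)
    qed
    also have "\<dots> = of_nat n * emeasure lborel (?A \<inter> {0..1})"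
      by (rule nn_integral_cmult_indicator) simp
    finally show ?thesis .
  qed
  have full: "of_nat n * emeasure lborel ?A = 1"
  proof -
    have "emeasure lborel ?A = ennreal (1 / n)"
      by (subst emeasure_lborel_Ico) (auto simp: divide_right_mono simp flip: diff_divide_distrib)
    then show ?thesis using n by (simp add: ennreal_of_nat_eq_real_of_nat flip: ennreal_mult)
  qed
  have "emeasure lborel (?A \<inter> {0..1}) \<le> emeasure lborel ?A" by (rule emeasure_mono) auto
  then show "(\<integral>\<^sup>+t. grid_density n s t \<partial>unit_interval) \<le> 1"
    unfolding eq full[symmetric] by (rule mult_left_mono) simp
  assume s: "0 \<le> s" "s < 1"
  \<comment> \<open>The right end of the cell is at most 1 because \<open>n\<close> is an integer: a
    floor below \<open>n\<close> is at most \<open>n - 1\<close>.\<close>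
  have "0 \<le> ?j" using s by simp
  moreover have "?j + 1 \<le> n"
  proof -
    have "n * s < n" using n s by simp
    then have "\<lfloor>n * s\<rfloor> < int n" by (simp add: floor_less_iff)
    then show ?thesis by linarith
  qed
  ultimately have "0 \<le> ?j / n" "(?j + 1) / n \<le> 1" using n by auto
  then have "?A \<inter> {0..1} = ?A" by auto
  then show "(\<integral>\<^sup>+t. grid_density n s t \<partial>unit_interval) = 1" unfolding eq by (simp only: full)
qed

text \<open>By measure preservation the two partial masses are those computed on
  \<open>unit_interval\<close>. The value 1, where mass may be missing, is attained by
  \<open>\<alpha>\<close> and \<open>\<beta>\<close> only on null sets.\<close>

lemma coupling_density_grid:
  assumes "prob_space T" "prob_space Q" and n: "0 < n"
    and \<alpha>: "\<alpha> \<in> measure_preserving T unit_interval" and \<beta>: "\<beta> \<in> measure_preserving Q unit_interval"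
  shows "coupling_density T Q (\<lambda>(t, q). grid_density n (\<alpha> t) (\<beta> q))"
proof -
  interpret T: prob_space T by fact
  interpret Q: prob_space Q by fact
  have am: "\<alpha> \<in> T \<rightarrow>\<^sub>M unit_interval" and bm: "\<beta> \<in> Q \<rightarrow>\<^sub>M unit_interval"
    using \<alpha> \<beta> by (auto simp: measure_preserving_def)
  have [measurable]: "\<alpha> \<in> borel_measurable T" "\<beta> \<in> borel_measurable Q"
    using am bm by (auto intro: measurable_unit_interval_real)
  have m: "(\<lambda>t. ennreal (grid_density n s t)) \<in> borel_measurable unit_interval" for s by measurable
  have ia: "(\<integral>\<^sup>+q. grid_density n s (\<beta> q) \<partial>Q) = (\<integral>\<^sup>+t. grid_density n s t \<partial>unit_interval)" for s
    by (rule nn_integral_measure_preserving[OF \<beta> m])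
  have ib: "(\<integral>\<^sup>+t. grid_density n (\<alpha> t) s \<partial>T) = (\<integral>\<^sup>+t. grid_density n s t \<partial>unit_interval)" for s
    unfolding grid_density_commute[of n _ s] by (rule nn_integral_measure_preserving[OF \<alpha> m])
  have lt: "AE x in X. (\<integral>\<^sup>+t. grid_density n (\<gamma> x) t \<partial>unit_interval) = 1"
    if \<gamma>: "\<gamma> \<in> measure_preserving X unit_interval" for X :: "'x measure" and \<gamma>
    using AE_measure_preserving[OF \<gamma> AE_unit_interval_less_1]
  proof (rule AE_mp, intro AE_I2 impI)
    fix x assume x: "x \<in> space X" "\<gamma> x < 1"
    then have "\<gamma> x \<in> space unit_interval"
      using \<gamma> by (auto simp: measure_preserving_def dest: measurable_space)
    then show "(\<integral>\<^sup>+t. grid_density n (\<gamma> x) t \<partial>unit_interval) = 1"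
      using x by (intro nn_integral_grid_density(2) n) auto
  qed
  show ?thesis
  proof
    show "(\<lambda>(t, q). grid_density n (\<alpha> t) (\<beta> q)) \<in> borel_measurable (T \<Otimes>\<^sub>M Q)" by measurable
    show "AE t in T. (\<integral>\<^sup>+q. (case (t, q) of (t, q) \<Rightarrow> grid_density n (\<alpha> t) (\<beta> q)) \<partial>Q) = 1"
      using lt[OF \<alpha>] by (simp add: ia)
    show "AE q in Q. (\<integral>\<^sup>+t. (case (t, q) of (t, q) \<Rightarrow> grid_density n (\<alpha> t) (\<beta> q)) \<partial>T) = 1"
      using lt[OF \<beta>] by (simp add: ib)
  qed (auto simp: grid_density_nonneg ia nn_integral_grid_density(1)[OF n])
qed

section \<open>Equality of the equivalence classes of \<open>W\<close> and \<open>G\<close>\<close>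

locale kernel_on_unit_interval = M: prob_space M + real_monotone_kernel G
  for M :: "'a measure" and G +
  fixes W :: "'a \<Rightarrow> 'a \<Rightarrow> real" and F :: "'a \<times> real \<Rightarrow> real"
  assumes kernel_W: "is_kernel M W"
    and F: "F \<in> measure_preserving (M \<Otimes>\<^sub>M unit_interval) unit_interval"
    and rep: "AE p in (M \<Otimes>\<^sub>M unit_interval) \<Otimes>\<^sub>M (M \<Otimes>\<^sub>M unit_interval).
      W (fst (fst p)) (fst (snd p)) = G (F (fst p)) (F (snd p))"
begin

sublocale I: prob_space unit_interval by (rule prob_space_unit_interval)

sublocale MI: pair_prob_space M unit_interval ..

lemma kernel_G: "is_kernel unit_interval G"
  using monotone_kernel_unit_interval by (simp add: monotone_kernel_def)

lemma fst_MI: "fst \<in> measure_preserving (M \<Otimes>\<^sub>M unit_interval) M"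
  by (simp add: measure_preserving_def I.distr_pair_fst)

lemma rep_pullback:
  assumes "prob_space S" and \<theta>: "\<theta> \<in> measure_preserving S (M \<Otimes>\<^sub>M unit_interval)"
  shows "AE p in S \<Otimes>\<^sub>M S. W (fst (\<theta> (fst p))) (fst (\<theta> (snd p))) = G (F (\<theta> (fst p))) (F (\<theta> (snd p)))"
  using AE_measure_preserving[OF measure_preserving_pair[OF assms(1) MI.prob_space_axioms \<theta>] rep]
  by (simp add: split_beta')

lemma cut_norm_pullback_le:
  assumes S: "prob_space S" and \<theta>: "\<theta> \<in> measure_preserving S (M \<Otimes>\<^sub>M unit_interval)"
    and V: "is_kernel N V" "\<psi> \<in> S \<rightarrow>\<^sub>M N"
  shows "cut_norm S (\<lambda>x y. pullback G (\<lambda>x. F (\<theta> x)) x y - pullback V \<psi> x y)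
    \<le> cut_norm S (\<lambda>x y. pullback W (\<lambda>x. fst (\<theta> x)) x y - pullback V \<psi> x y)"
proof -
  have m: "(\<lambda>x. F (\<theta> x)) \<in> S \<rightarrow>\<^sub>M unit_interval" "(\<lambda>x. fst (\<theta> x)) \<in> S \<rightarrow>\<^sub>M M"
    using measure_preserving_comp[OF \<theta> F] measure_preserving_comp[OF \<theta> fst_MI]
    by (auto simp: measure_preserving_def)
  show ?thesis
    using cut_norm_perturb[OF S pullback_diff[OF kernel_G V(1) m(1) V(2)]
        pullback_diff[OF kernel_W V(1) m(2) V(2)], of "\<lambda>_. 0"] rep_pullback[OF S \<theta>]
    by (simp add: pullback_def eq_commute[of "G _ _"])
qed

text \<open>The enlarged space, with the maps \<open>fst\<close> and \<open>F\<close>, is itself a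
  coupling on which the two pullbacks agree almost everywhere.\<close>

lemma equivalent_unit_interval: "equivalent_kernels M W unit_interval G"
proof (rule equivalent_kernelsI[OF M.prob_space_axioms I.prob_space_axioms kernel_W kernel_G])
  fix e :: real assume "e > 0"
  have m: "fst \<in> (M \<Otimes>\<^sub>M unit_interval) \<rightarrow>\<^sub>M M" "F \<in> (M \<Otimes>\<^sub>M unit_interval) \<rightarrow>\<^sub>M unit_interval"
    using F by (auto simp: measure_preserving_def)
  have "delta_cut M W unit_interval G
      \<le> cut_norm (M \<Otimes>\<^sub>M unit_interval) (\<lambda>x y. pullback W fst x y - pullback G F x y)"
    by (rule delta_cut_le[OF kernel_W kernel_G MI.prob_space_axioms fst_MI F])
  also have "\<dots> \<le> cut_norm (M \<Otimes>\<^sub>M unit_interval) (\<lambda>x y. 0)"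
    using cut_norm_perturb[OF MI.prob_space_axioms pullback_diff[OF kernel_W kernel_G m], of "\<lambda>_ _. 0" "\<lambda>_. 0"] rep
    by (simp add: pullback_def)
  also have "\<dots> \<le> 0" by (rule cut_norm_le) (simp add: split_beta')
  finally show "delta_cut M W unit_interval G \<le> e" using \<open>e > 0\<close> by simp
qed

text \<open>A coupling of \<open>M\<close> and \<open>N\<close> provides a point of
  \<open>M\<close>, whereas \<open>F\<close> also takes a uniform coordinate. Attaching an
  independent one, which is a coupling of density 1, does not increase the cut norm.\<close>

lemma equivalent_imp_unit_interval:
  assumes N: "prob_space N" and V: "is_kernel N V" and eq: "equivalent_kernels M W N V"
  shows "equivalent_kernels unit_interval G N V"
proof (rule equivalent_kernelsI[OF I.prob_space_axioms N kernel_G V])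
  fix e :: real assume "e > 0"
  then have "delta_cut M W N V < e" using eq by (simp add: equivalent_kernels_def)
  from delta_cut_lessD[OF M.prob_space_axioms N kernel_W V this]
  obtain T :: "('a \<times> 'b) measure" and \<phi> \<psi> where T: "prob_space T"
    and \<phi>: "\<phi> \<in> measure_preserving T M" and \<psi>: "\<psi> \<in> measure_preserving T N"
    and c: "cut_norm T (\<lambda>x y. pullback W \<phi> x y - pullback V \<psi> x y) < e" by blast
  interpret T: prob_space T by fact
  interpret C: coupling_density T unit_interval "\<lambda>_. 1"
    by unfold_locales (auto simp: T.emeasure_space_1 I.emeasure_space_1[simplified])
  note S = C.prob_space_coupling
  have C: "C.coupling = T \<Otimes>\<^sub>M unit_interval"
    by (simp add: C.coupling_def density_1)
  have \<phi>m [measurable]: "\<phi> \<in> T \<rightarrow>\<^sub>M M" and \<phi>d: "distr T M \<phi> = M" and \<psi>m: "\<psi> \<in> T \<rightarrow>\<^sub>M N"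
    using \<phi> \<psi> by (auto simp: measure_preserving_def)
  \<comment> \<open>The map to the enlarged space of \<open>M\<close>: the point given by
    \<open>\<phi>\<close>, with the fresh uniform coordinate.\<close>
  define \<theta> where "\<theta> p = (\<phi> (fst p), snd p)" for p :: "('a \<times> 'b) \<times> real"
  have "M \<Otimes>\<^sub>M unit_interval = distr (T \<Otimes>\<^sub>M unit_interval) (M \<Otimes>\<^sub>M unit_interval) (\<lambda>(x, y). (\<phi> x, y))"
    using pair_measure_distr[OF \<phi>m measurable_ident, of unit_interval] \<phi>d I.sigma_finite_measure_axioms
    by (simp add: distr_id id_def)
  then have \<theta>: "\<theta> \<in> measure_preserving C.coupling (M \<Otimes>\<^sub>M unit_interval)"
    unfolding C by (simp add: measure_preserving_def \<theta>_def[abs_def] split_beta')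
  have \<psi>': "(\<lambda>p. \<psi> (fst p)) \<in> measure_preserving C.coupling N"
    by (rule measure_preserving_comp[OF C.fst_measure_preserving \<psi>])
  have "delta_cut unit_interval G N V \<le>
      cut_norm C.coupling (\<lambda>x y. pullback G (\<lambda>x. F (\<theta> x)) x y - pullback V (\<lambda>p. \<psi> (fst p)) x y)"
    by (rule delta_cut_le[OF kernel_G V S measure_preserving_comp[OF \<theta> F] \<psi>'])
  also have "\<dots> \<le> cut_norm C.coupling (\<lambda>x y. pullback W (\<lambda>x. fst (\<theta> x)) x y - pullback V (\<lambda>p. \<psi> (fst p)) x y)"
    using \<psi>' by (intro cut_norm_pullback_le[OF S \<theta> V]) (simp add: measure_preserving_def)
  also have "\<dots> \<le> cut_norm T (\<lambda>x y. pullback W \<phi> x y - pullback V \<psi> x y)"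
    using C.cut_norm_coupling_le[OF pullback_diff[OF kernel_W V \<phi>m \<psi>m]]
    by (simp add: pullback_def \<theta>_def)
  finally show "delta_cut unit_interval G N V \<le> e" using c by simp
qed

text \<open>Without regularity of \<open>M\<close> two couplings cannot be glued along \<open>unit_interval\<close> exactly. They
  are glued along the partition into intervals of length \<open>1 / n\<close> instead, which by
  monotonicity moves \<open>G\<close> by at most \<open>4 / n\<close> in \<open>L\<^sup>1\<close>.\<close>

lemma equivalent_if_unit_interval:
  assumes N: "prob_space N" and V: "is_kernel N V" and eq: "equivalent_kernels unit_interval G N V"
  shows "equivalent_kernels M W N V"
proof (rule equivalent_kernelsI[OF M.prob_space_axioms N kernel_W V])
  fix e :: real assume e: "e > 0"
  then have "delta_cut unit_interval G N V < e / 2" using eq by (simp add: equivalent_kernels_def)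
  from delta_cut_lessD[OF I.prob_space_axioms N kernel_G V this]
  obtain T :: "(real \<times> 'b) measure" and \<phi> \<psi> where T: "prob_space T"
    and \<phi>: "\<phi> \<in> measure_preserving T unit_interval" and \<psi>: "\<psi> \<in> measure_preserving T N"
    and c: "cut_norm T (\<lambda>x y. pullback G \<phi> x y - pullback V \<psi> x y) < e / 2" by blast
  \<comment> \<open>Half of \<open>e\<close> goes to the given coupling, and the other half covers
    the gluing error \<open>4 / n\<close>.\<close>
  obtain n :: nat where n: "0 < n" "1 / n < e / 8"
    using nat_approx_posE[of "e / 8"] e zero_less_Suc by (metis divide_pos_pos zero_less_numeral)
  define h where "h = 1 / real n"
  have h: "0 \<le> h" "4 * h < e / 2" using n by (auto simp: h_def)
  interpret T: prob_space T by fact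
  define \<kappa> where "\<kappa> = (\<lambda>(t, q). grid_density n (\<phi> t) (F q))"
  \<comment> \<open>Pairs a point of \<open>T\<close> with a point of the enlarged space of
    \<open>M\<close> when \<open>\<phi>\<close> and \<open>F\<close> send them to the same
    cell.\<close>
  interpret C: coupling_density T "M \<Otimes>\<^sub>M unit_interval" \<kappa>
    unfolding \<kappa>_def by (rule coupling_density_grid[OF T MI.prob_space_axioms n(1) \<phi> F])
  let ?S = C.coupling
  note S = C.prob_space_coupling
  interpret S: prob_space ?S by (rule S)
  interpret SS: pair_prob_space ?S ?S ..
  interpret II: pair_prob_space unit_interval unit_interval ..
  have \<phi>m: "\<phi> \<in> T \<rightarrow>\<^sub>M unit_interval" and \<psi>m: "\<psi> \<in> T \<rightarrow>\<^sub>M N"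
    using \<phi> \<psi> by (auto simp: measure_preserving_def)
  define \<alpha> where "\<alpha> p = \<phi> (fst p)" for p :: "(real \<times> 'b) \<times> ('a \<times> real)"
  have \<alpha>: "\<alpha> \<in> measure_preserving ?S unit_interval"
    unfolding \<alpha>_def by (rule measure_preserving_comp[OF C.fst_measure_preserving \<phi>])
  have \<psi>': "(\<lambda>p. \<psi> (fst p)) \<in> measure_preserving ?S N"
    by (rule measure_preserving_comp[OF C.fst_measure_preserving \<psi>])
  have \<omega>: "(\<lambda>p. fst (snd p)) \<in> measure_preserving ?S M"
    by (rule measure_preserving_comp[OF C.snd_measure_preserving fst_MI])
  have Fs: "(\<lambda>p. F (snd p)) \<in> measure_preserving ?S unit_interval"
    by (rule measure_preserving_comp[OF C.snd_measure_preserving F])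
  have m: "\<alpha> \<in> ?S \<rightarrow>\<^sub>M unit_interval" "(\<lambda>p. \<psi> (fst p)) \<in> ?S \<rightarrow>\<^sub>M N" "(\<lambda>p. fst (snd p)) \<in> ?S \<rightarrow>\<^sub>M M"
    "(\<lambda>p. F (snd p)) \<in> ?S \<rightarrow>\<^sub>M unit_interval"
    using \<alpha> \<psi>' \<omega> Fs by (auto simp: measure_preserving_def)
  have [measurable]: "\<alpha> \<in> borel_measurable ?S"
    using m(1) by (rule measurable_unit_interval_real)

  \<comment> \<open>When \<open>\<alpha>\<close> and \<open>F\<close> differ by at most
    \<open>h\<close> in both arguments, both values of \<open>G\<close> lie between those at the
    arguments \<open>\<alpha> - h\<close> and \<open>\<alpha> + h\<close>; this gap majorises their
    difference.\<close>
  let ?D = "\<lambda>p. G (fst p + h) (snd p + h) - G (fst p - h) (snd p - h)"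
  have D: "integrable (?S \<Otimes>\<^sub>M ?S) (\<lambda>p. ?D (case p of (x, y) \<Rightarrow> (\<alpha> x, \<alpha> y)))"
    by (rule SS.integrable_const_bound[where B = 1]) (auto simp: split_beta' abs_diff_le_1)
  have Dle: "(\<integral>p. ?D (case p of (x, y) \<Rightarrow> (\<alpha> x, \<alpha> y)) \<partial>(?S \<Otimes>\<^sub>M ?S)) \<le> 4 * h"
  proof -
    interpret H: real_monotone_kernel "\<lambda>s t. G (s + (- h)) (t + (- h))" by (rule shift)
    have [measurable]: "fst \<in> borel_measurable (unit_interval \<Otimes>\<^sub>M unit_interval)"
      "snd \<in> borel_measurable (unit_interval \<Otimes>\<^sub>M unit_interval)"
      by (rule measurable_unit_interval_real; measurable)+
    \<comment> \<open>The gap splits at the unshifted point. The upper half is a translation of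
      \<open>G\<close> by \<open>h\<close>, the lower half one of its translate by
      \<open>- h\<close>, each costing \<open>2 * h\<close>.\<close>
    let ?a = "\<lambda>p. G (fst p + h) (snd p + h) - G (fst p) (snd p)"
    let ?b = "\<lambda>p. G (fst p + h + - h) (snd p + h + - h) - G (fst p + - h) (snd p + - h)"
    have "(\<integral>p. ?D (case p of (x, y) \<Rightarrow> (\<alpha> x, \<alpha> y)) \<partial>(?S \<Otimes>\<^sub>M ?S)) = (\<integral>p. ?D p \<partial>(unit_interval \<Otimes>\<^sub>M unit_interval))"
      by (rule integral_measure_preserving[OF measure_preserving_pair[OF S I.prob_space_axioms \<alpha>]]) measurable
    also have "\<dots> = (\<integral>p. ?a p + ?b p \<partial>(unit_interval \<Otimes>\<^sub>M unit_interval))" by simp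
    also have "\<dots> = (\<integral>p. ?a p \<partial>(unit_interval \<Otimes>\<^sub>M unit_interval)) + (\<integral>p. ?b p \<partial>(unit_interval \<Otimes>\<^sub>M unit_interval))"
      by (rule Bochner_Integration.integral_add;
          rule II.integrable_const_bound[where B = 1]; (simp add: abs_diff_le_1 del: add_uminus_conv_diff)?)
    also have "\<dots> \<le> 2 * h + 2 * h"
      by (intro add_mono integral_shift_le_pair H.integral_shift_le_pair h)
    finally show ?thesis by simp
  qed
  have near: "AE p in ?S. \<bar>\<alpha> p - F (snd p)\<bar> \<le> h"
  proof -
    \<comment> \<open>The points where the density vanishes are null for the coupling, so closeness
      of the two variables holds almost surely.\<close>
    have "AE p in ?S. 0 < \<kappa> p"
      unfolding C.coupling_def by (subst AE_density) auto
    then show ?thesis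
      by eventually_elim (auto simp: \<alpha>_def \<kappa>_def h_def intro: grid_density_pos_imp[OF n(1)])
  qed
  have near2: "AE p in ?S \<Otimes>\<^sub>M ?S. \<bar>\<alpha> (fst p) - F (snd (fst p))\<bar> \<le> h \<and> \<bar>\<alpha> (snd p) - F (snd (snd p))\<bar> \<le> h"
  proof (rule SS.AE_pair_measure)
    define \<beta> where "\<beta> p = F (snd p)" for p :: "(real \<times> 'b) \<times> ('a \<times> real)"
    have [measurable]: "\<beta> \<in> borel_measurable ?S"
      unfolding \<beta>_def using m(4) by (rule measurable_unit_interval_real)
    have "{p \<in> space (?S \<Otimes>\<^sub>M ?S). \<bar>\<alpha> (fst p) - \<beta> (fst p)\<bar> \<le> h \<and> \<bar>\<alpha> (snd p) - \<beta> (snd p)\<bar> \<le> h}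
        \<in> sets (?S \<Otimes>\<^sub>M ?S)" by measurable
    then show "{p \<in> space (?S \<Otimes>\<^sub>M ?S). \<bar>\<alpha> (fst p) - F (snd (fst p))\<bar> \<le> h \<and> \<bar>\<alpha> (snd p) - F (snd (snd p))\<bar> \<le> h}
        \<in> sets (?S \<Otimes>\<^sub>M ?S)" by (simp only: \<beta>_def)
  qed (use near in auto)
  have D_bound: "AE p in ?S \<Otimes>\<^sub>M ?S. \<bar>(pullback W (\<lambda>p. fst (snd p)) (fst p) (snd p) - pullback V (\<lambda>p. \<psi> (fst p)) (fst p) (snd p))
      - (pullback G \<alpha> (fst p) (snd p) - pullback V (\<lambda>p. \<psi> (fst p)) (fst p) (snd p))\<bar>
      \<le> ?D (case p of (x, y) \<Rightarrow> (\<alpha> x, \<alpha> y))"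
    using near2 rep_pullback[OF S C.snd_measure_preserving]
  proof eventually_elim
    fix p
    assume p: "\<bar>\<alpha> (fst p) - F (snd (fst p))\<bar> \<le> h \<and> \<bar>\<alpha> (snd p) - F (snd (snd p))\<bar> \<le> h"
      and w: "W (fst (snd (fst p))) (fst (snd (snd p))) = G (F (snd (fst p))) (F (snd (snd p)))"
    let ?x = "\<alpha> (fst p)" and ?y = "\<alpha> (snd p)"
    let ?s = "F (snd (fst p))" and ?t = "F (snd (snd p))"
    have "G ?s ?t \<le> G (?x + h) (?y + h)" "G ?x ?y \<le> G (?x + h) (?y + h)"
      "G (?x - h) (?y - h) \<le> G ?s ?t" "G (?x - h) (?y - h) \<le> G ?x ?y"
      using p h(1) by (auto intro!: mono simp: abs_le_iff)
    then show "\<bar>(pullback W (\<lambda>p. fst (snd p)) (fst p) (snd p) - pullback V (\<lambda>p. \<psi> (fst p)) (fst p) (snd p))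
      - (pullback G \<alpha> (fst p) (snd p) - pullback V (\<lambda>p. \<psi> (fst p)) (fst p) (snd p))\<bar>
      \<le> ?D (case p of (x, y) \<Rightarrow> (\<alpha> x, \<alpha> y))"
      by (simp add: pullback_def w split_beta' abs_le_iff)
  qed
  have "delta_cut M W N V \<le>
      cut_norm ?S (\<lambda>x y. pullback W (\<lambda>p. fst (snd p)) x y - pullback V (\<lambda>p. \<psi> (fst p)) x y)"
    by (rule delta_cut_le[OF kernel_W V S \<omega> \<psi>'])
  also have "\<dots> \<le> cut_norm ?S (\<lambda>x y. pullback G \<alpha> x y - pullback V (\<lambda>p. \<psi> (fst p)) x y)
      + (\<integral>p. ?D (case p of (x, y) \<Rightarrow> (\<alpha> x, \<alpha> y)) \<partial>(?S \<Otimes>\<^sub>M ?S))"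
    by (rule cut_norm_perturb[OF S pullback_diff[OF kernel_W V m(3,2)] pullback_diff[OF kernel_G V m(1,2)] D D_bound])
  also have "cut_norm ?S (\<lambda>x y. pullback G \<alpha> x y - pullback V (\<lambda>p. \<psi> (fst p)) x y)
      \<le> cut_norm T (\<lambda>x y. pullback G \<phi> x y - pullback V \<psi> x y)"
    using C.cut_norm_coupling_le[OF pullback_diff[OF kernel_G V \<phi>m \<psi>m]]
    by (simp add: pullback_def \<alpha>_def)
  finally show "delta_cut M W N V \<le> e" using c Dle h by linarith
qed

end

theorem theorem4p3:
  fixes M :: "'a measure" and r :: "'a rel" and W :: "'a \<Rightarrow> 'a \<Rightarrow> real"
  assumes "ordered_prob_space M r"
    and "monotone_kernel M r W"
  shows "(\<exists>W'. monotone_kernel unit_interval unit_order W' \<and>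
              equivalent_kernels M W unit_interval W') \<and>
         (graph_limit M W :: ('c measure \<times> ('c \<Rightarrow> 'c \<Rightarrow> real)) set) \<in> monotone_graph_limits"
proof -
  interpret ordered_prob_space M r by fact
  obtain F G where F: "F \<in> measure_preserving (M \<Otimes>\<^sub>M unit_interval) unit_interval"
    and G: "real_monotone_kernel G"
    and rep: "AE p in (M \<Otimes>\<^sub>M unit_interval) \<Otimes>\<^sub>M (M \<Otimes>\<^sub>M unit_interval).
      W (fst (fst p)) (fst (snd p)) = G (F (fst p)) (F (snd p))"
    using monotone_kernel_representation[OF assms(2)] by blast
  interpret real_monotone_kernel G by (rule G)
  interpret K: kernel_on_unit_interval M G W F
    by unfold_locales (use assms(2) F rep in \<open>auto simp: monotone_kernel_def\<close>)
  \<comment> \<open>The two inclusions are the two transitivity statements, with \<open>N\<close>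
    and \<open>V\<close> ranging over the carrier type \<open>'c\<close>.\<close>
  have "(graph_limit M W :: ('c measure \<times> ('c \<Rightarrow> 'c \<Rightarrow> real)) set) = graph_limit unit_interval G"
    using K.equivalent_imp_unit_interval K.equivalent_if_unit_interval unfolding graph_limit_def by blast
  then show ?thesis
    using K.equivalent_unit_interval monotone_kernel_unit_interval unfolding monotone_graph_limits_def by blast
qed

end
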